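(* Let $i:Z\hookrightarrow X$ be a closed immersion, $g:X'\to X$ a morphism, and let $i':Z'\hookrightarrow X'$ and $g_Z:Z'\to Z$ be such that the square with $i\circ g_Z=g\circ i'$ is Cartesian. Let $j:U\hookrightarrow X$ and $j':U'\hookrightarrow X'$ be the open complements of $Z$ and $Z'$, with induced map $g_U:U'\to U$. Assume the recollement axioms for $(i,j)$ and $(i',j')$. Let $A\in\mathcal C(X)$ and $d\in\mathbb Z$, and assume Beck–Chevalley holds for the closed square and for the induced open square, so that there are canonical isomorphisms $$g^*i_*\simeq i'_*g_Z^*,\qquad g_Z^*i^!\simeq i'^!g^*,\qquad j'^*g^*\simeq g_U^*j^*.$$ Let $c\in H^d(X;A)$ satisfy $j^*(c)=0$. Then $j'^*(g^*c)=0$ and, after identifying $g_Z^*i^!A\simeq i'^!g^*A$ by base change, pullback induces a natural morphism of torsors $$g_Z^*:\mathrm{Loc}_Z^{\mathrm{tor}}(c)\longrightarrow\mathrm{Loc}_{Z'}^{\mathrm{tor}}(g^*c)\quad\text{inside}\quad\mathrm{Hom}_{\mathcal C(Z')}(\mathbf 1_{Z'},i'^!g^*A[d]).$$ In particular, if both torsors are singletons, with elements $\mathrm{Loc}_Z(c)$ and $\mathrm{Loc}_{Z'}(g^*c)$, then $\mathrm{Loc}_{Z'}(g^*c)=g_Z^*\mathrm{Loc}_Z(c)$ in $\mathrm{Hom}_{\mathcal C(Z')}(\mathbf 1_{Z'},i'^!g^*A[d])$.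
   Context: Setting: to each space $X$ is attached a stable triangulated category $\mathcal C(X)$ with a symmetric monoidal structure $(\otimes,\mathbf 1_X)$. Each morphism $f:X\to Y$ has exact functors $f^*\dashv f_*$, with $f^*$ symmetric monoidal, so $f^*\mathbf 1_Y\simeq\mathbf 1_X$; pullback on classes is $f^*:H^d(Y;A)\to H^d(X;f^*A)$. Recollement axioms for a closed immersion $i:Z\hookrightarrow X$ with open complement $j:U=X\setminus Z\hookrightarrow X$: adjunctions $i^*\dashv i_*\dashv i^!$ and $j_!\dashv j^*\dashv j_*$; $i_*$ and $j_!$ fully faithful; $j^*i_*=0$ and $i^*j_!=0$; functorial distinguished triangles $j_!j^*M\to M\to i_*i^*M\xrightarrow{+1}$ and $i_*i^!M\to M\to j_*j^*M\xrightarrow{+1}$ (maps given by adjunction units and counits). Definitions: $H^d(X;A)=\mathrm{Hom}_{\mathcal C(X)}(\mathbf 1_X,A[d])$; $H_Z^d(X;A)=\mathrm{Hom}_{\mathcal C(X)}(\mathbf 1_X,i_*i^!A[d])$; $\mathrm{forg}:H_Z^d(X;A)\to H^d(X;A)$ is induced by the counit $i_*i^!A\to A$. For $c$ with $j^*c=0$, $\mathrm{Lift}_Z^d(c)=\{\widetilde c\in H_Z^d(X;A)\mid\mathrm{forg}(\widetilde c)=c\}$, and $\mathrm{Loc}_Z^{\mathrm{tor}}(c)\subset\mathrm{Hom}_{\mathcal C(Z)}(\mathbf 1_Z,i^!A[d])$ is its image under the adjunction isomorphism $H_Z^d(X;A)\cong\mathrm{Hom}_{\mathcal C(Z)}(\mathbf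 1_Z,i^!A[d])$. It is a torsor under the (adjoint of the) group $\ker(\mathrm{forg})=\mathrm{im}(\delta:H^{d-1}(U;j^*A)\to H_Z^d(X;A))$, where $\delta$ is the connecting morphism of $i_*i^!A\to A\to j_*j^*A\xrightarrow{+1}$. A morphism of torsors is a map equivariant with respect to the induced homomorphism between the acting groups. The Beck–Chevalley isomorphisms are the canonical exchange morphisms built from the adjunctions; in particular they are compatible with the counits $i_*i^!\to\mathrm{id}$ and $i'_*i'^!\to\mathrm{id}$. *)

theory Defs
  imports "HOL-Algebra.Group_Action"
begin

section \<open>Categories, functors, adjunctions\<close>

record ('o, 'm) cat =
  Obj :: "'o set"
  Arr :: "'m set"
  Dom :: "'m \<Rightarrow> 'o"
  Cod :: "'m \<Rightarrow> 'o"
  Idn :: "'o \<Rightarrow> 'm"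
  Comp :: "'m \<Rightarrow> 'm \<Rightarrow> 'm"  (infixr \<open>\<cdot>\<index>\<close> 70)

definition homs :: "('o, 'm, 'z) cat_scheme \<Rightarrow> 'o \<Rightarrow> 'o \<Rightarrow> 'm set" where
  "homs C A B = {f \<in> Arr C. Dom C f = A \<and> Cod C f = B}"

locale category =
  fixes C :: "('o, 'm, 'z) cat_scheme" (structure)
  assumes Dom_Obj: "f \<in> Arr C \<Longrightarrow> Dom C f \<in> Obj C"
    and Cod_Obj: "f \<in> Arr C \<Longrightarrow> Cod C f \<in> Obj C"
    and Idn_homs: "A \<in> Obj C \<Longrightarrow> Idn C A \<in> homs C A A"
    and Comp_homs: "\<lbrakk>f \<in> homs C A B; g \<in> homs C B D\<rbrakk> \<Longrightarrow> g \<cdot> f \<in> homs C A D"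
    and Idn_left: "f \<in> homs C A B \<Longrightarrow> Idn C B \<cdot> f = f"
    and Idn_right: "f \<in> homs C A B \<Longrightarrow> f \<cdot> Idn C A = f"
    and Comp_assoc: "\<lbrakk>f \<in> homs C A B; g \<in> homs C B D; h \<in> homs C D E\<rbrakk>
      \<Longrightarrow> (h \<cdot> g) \<cdot> f = h \<cdot> (g \<cdot> f)"

definition inverse_arrs :: "('o, 'm, 'z) cat_scheme \<Rightarrow> 'm \<Rightarrow> 'm \<Rightarrow> bool" where
  "inverse_arrs C f g \<longleftrightarrow> f \<in> Arr C \<and> g \<in> homs C (Cod C f) (Dom C f) \<and>
     g \<cdot>\<^bsub>C\<^esub> f = Idn C (Dom C f) \<and> f \<cdot>\<^bsub>C\<^esub> g = Idn C (Cod C f)"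

definition iso_arr :: "('o, 'm, 'z) cat_scheme \<Rightarrow> 'm \<Rightarrow> bool" where
  "iso_arr C f \<longleftrightarrow> (\<exists>g. inverse_arrs C f g)"

definition inv_arr :: "('o, 'm, 'z) cat_scheme \<Rightarrow> 'm \<Rightarrow> 'm" where
  "inv_arr C f = (THE g. inverse_arrs C f g)"

definition is_zero_object :: "('o, 'm, 'z) cat_scheme \<Rightarrow> 'o \<Rightarrow> bool" where
  "is_zero_object C Z \<longleftrightarrow> Z \<in> Obj C \<and>
     (\<forall>A\<in>Obj C. (\<exists>!f. f \<in> homs C A Z) \<and> (\<exists>!f. f \<in> homs C Z A))"

text \<open>The square is \<open>f \<circ> h' = h \<circ> f'\<close>, with \<open>f\<close> and \<open>h\<close> having the same codomain.\<close>

definition commutative_square :: "('o, 'm, 'z) cat_scheme \<Rightarrow> 'm \<Rightarrow> 'm \<Rightarrow> 'm \<Rightarrow> 'm \<Rightarrow> bool" where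
  "commutative_square C f h' h f' \<longleftrightarrow>
     f \<in> Arr C \<and> h' \<in> Arr C \<and> h \<in> Arr C \<and> f' \<in> Arr C \<and>
     Cod C h' = Dom C f \<and> Cod C f' = Dom C h \<and>
     Dom C h' = Dom C f' \<and> Cod C f = Cod C h \<and>
     f \<cdot>\<^bsub>C\<^esub> h' = h \<cdot>\<^bsub>C\<^esub> f'"

definition cartesian_square :: "('o, 'm, 'z) cat_scheme \<Rightarrow> 'm \<Rightarrow> 'm \<Rightarrow> 'm \<Rightarrow> 'm \<Rightarrow> bool" where
  "cartesian_square C f h' h f' \<longleftrightarrow> commutative_square C f h' h f' \<and>
     (\<forall>W\<in>Obj C. \<forall>a\<in>homs C W (Dom C f). \<forall>b\<in>homs C W (Dom C h). f \<cdot>\<^bsub>C\<^esub> a = h \<cdot>\<^bsub>C\<^esub> b \<longrightarrow>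
        (\<exists>!k. k \<in> homs C W (Dom C f') \<and> h' \<cdot>\<^bsub>C\<^esub> k = a \<and> f' \<cdot>\<^bsub>C\<^esub> k = b))"

record ('o, 'm, 'p, 'n) ftor =
  fobj :: "'o \<Rightarrow> 'p"
  farr :: "'m \<Rightarrow> 'n"

definition id_ftor :: "('o, 'm, 'o, 'm) ftor" where
  "id_ftor = \<lparr>fobj = \<lambda>A. A, farr = \<lambda>f. f\<rparr>"

definition comp_ftor ::
  "('p, 'n, 'q, 'k, 'x) ftor_scheme \<Rightarrow> ('o, 'm, 'p, 'n, 'y) ftor_scheme \<Rightarrow> ('o, 'm, 'q, 'k) ftor" where
  "comp_ftor G F = \<lparr>fobj = \<lambda>A. fobj G (fobj F A), farr = \<lambda>f. farr G (farr F f)\<rparr>"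

locale category_functor = C: category C + D: category D
  for C :: "('o, 'm, 'z) cat_scheme" and D :: "('p, 'n, 'w) cat_scheme" +
  fixes F :: "('o, 'm, 'p, 'n, 'x) ftor_scheme"
  assumes fobj_Obj: "A \<in> Obj C \<Longrightarrow> fobj F A \<in> Obj D"
    and farr_homs: "f \<in> homs C A B \<Longrightarrow> farr F f \<in> homs D (fobj F A) (fobj F B)"
    and farr_Idn: "A \<in> Obj C \<Longrightarrow> farr F (Idn C A) = Idn D (fobj F A)"
    and farr_Comp: "\<lbrakk>f \<in> homs C A B; g \<in> homs C B E\<rbrakk>
      \<Longrightarrow> farr F (g \<cdot>\<^bsub>C\<^esub> f) = farr F g \<cdot>\<^bsub>D\<^esub> farr F f"

definition nat_trans ::
  "('o, 'm, 'z) cat_scheme \<Rightarrow> ('p, 'n, 'w) cat_scheme \<Rightarrow> ('o, 'm, 'p, 'n, 'x) ftor_scheme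
    \<Rightarrow> ('o, 'm, 'p, 'n, 'y) ftor_scheme \<Rightarrow> ('o \<Rightarrow> 'n) \<Rightarrow> bool" where
  "nat_trans C D F G t \<longleftrightarrow>
     (\<forall>A\<in>Obj C. t A \<in> homs D (fobj F A) (fobj G A)) \<and>
     (\<forall>f\<in>Arr C. t (Cod C f) \<cdot>\<^bsub>D\<^esub> farr F f = farr G f \<cdot>\<^bsub>D\<^esub> t (Dom C f))"

definition nat_iso ::
  "('o, 'm, 'z) cat_scheme \<Rightarrow> ('p, 'n, 'w) cat_scheme \<Rightarrow> ('o, 'm, 'p, 'n, 'x) ftor_scheme
    \<Rightarrow> ('o, 'm, 'p, 'n, 'y) ftor_scheme \<Rightarrow> ('o \<Rightarrow> 'n) \<Rightarrow> bool" where
  "nat_iso C D F G t \<longleftrightarrow> nat_trans C D F G t \<and> (\<forall>A\<in>Obj C. iso_arr D (t A))"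

definition fully_faithful ::
  "('o, 'm, 'z) cat_scheme \<Rightarrow> ('p, 'n, 'w) cat_scheme \<Rightarrow> ('o, 'm, 'p, 'n, 'x) ftor_scheme \<Rightarrow> bool" where
  "fully_faithful C D F \<longleftrightarrow>
     (\<forall>A\<in>Obj C. \<forall>B\<in>Obj C. bij_betw (farr F) (homs C A B) (homs D (fobj F A) (fobj F B)))"

text \<open>\<open>F \<stileturn> G\<close> with unit \<open>\<eta> : id \<rightarrow> G F\<close> and counit \<open>\<epsilon> : F G \<rightarrow> id\<close>.\<close>

locale adjunction = F: category_functor C D F + G: category_functor D C G
  for C :: "('o, 'm, 'z) cat_scheme" and D :: "('p, 'n, 'w) cat_scheme"
    and F :: "('o, 'm, 'p, 'n, 'x) ftor_scheme" and G :: "('p, 'n, 'o, 'm, 'y) ftor_scheme" +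
  fixes \<eta> :: "'o \<Rightarrow> 'm" and \<epsilon> :: "'p \<Rightarrow> 'n"
  assumes unit_nat: "nat_trans C C id_ftor (comp_ftor G F) \<eta>"
    and counit_nat: "nat_trans D D (comp_ftor F G) id_ftor \<epsilon>"
    and triangle_left: "A \<in> Obj C \<Longrightarrow> \<epsilon> (fobj F A) \<cdot>\<^bsub>D\<^esub> farr F (\<eta> A) = Idn D (fobj F A)"
    and triangle_right: "B \<in> Obj D \<Longrightarrow> farr G (\<epsilon> B) \<cdot>\<^bsub>C\<^esub> \<eta> (fobj G B) = Idn C (fobj G B)"


section \<open>Triangulated categories and exact functors\<close>

record ('o, 'm) add_cat = "('o, 'm) cat" +
  Zer :: "'o \<Rightarrow> 'o \<Rightarrow> 'm"
  Add :: "'m \<Rightarrow> 'm \<Rightarrow> 'm"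

text \<open>The abelian group of morphisms, written with the (multiplicative) library signature.\<close>

definition hom_group :: "('o, 'm, 'z) add_cat_scheme \<Rightarrow> 'o \<Rightarrow> 'o \<Rightarrow> 'm monoid" where
  "hom_group C A B = \<lparr>carrier = homs C A B, mult = Add C, one = Zer C A B\<rparr>"

definition neg_arr :: "('o, 'm, 'z) add_cat_scheme \<Rightarrow> 'm \<Rightarrow> 'm" where
  "neg_arr C f = inv\<^bsub>hom_group C (Dom C f) (Cod C f)\<^esub> f"

locale additive_category = category C for C :: "('o, 'm, 'z) add_cat_scheme" (structure) +
  assumes hom_comm_group: "\<lbrakk>A \<in> Obj C; B \<in> Obj C\<rbrakk> \<Longrightarrow> comm_group (hom_group C A B)"
    and Comp_Add_right: "\<lbrakk>f \<in> homs C A B; g \<in> homs C A B; h \<in> homs C B D\<rbrakk>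
      \<Longrightarrow> h \<cdot> Add C f g = Add C (h \<cdot> f) (h \<cdot> g)"
    and Comp_Add_left: "\<lbrakk>f \<in> homs C B D; g \<in> homs C B D; h \<in> homs C A B\<rbrakk>
      \<Longrightarrow> Add C f g \<cdot> h = Add C (f \<cdot> h) (g \<cdot> h)"
    and zero_object: "\<exists>Z. is_zero_object C Z"
    and biproducts: "\<lbrakk>A \<in> Obj C; B \<in> Obj C\<rbrakk> \<Longrightarrow>
      \<exists>P\<in>Obj C. \<exists>a\<in>homs C A P. \<exists>b\<in>homs C B P. \<exists>p\<in>homs C P A. \<exists>q\<in>homs C P B.
        p \<cdot> a = Idn C A \<and> q \<cdot> b = Idn C B \<and> p \<cdot> b = Zer C B A \<and> q \<cdot> a = Zer C A B \<and>
        Add C (a \<cdot> p) (b \<cdot> q) = Idn C P"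

text \<open>The shifts \<open>A[n]\<close>, \<open>n \<in> \<int>\<close>, form a strict action of \<open>\<int>\<close> by additive functors. A triangle
  \<open>A \<rightarrow> B \<rightarrow> D \<rightarrow> A[1]\<close> is the triple of its three arrows.\<close>

record ('o, 'm) tri_cat = "('o, 'm) add_cat" +
  shO :: "int \<Rightarrow> 'o \<Rightarrow> 'o"
  shA :: "int \<Rightarrow> 'm \<Rightarrow> 'm"
  Tri :: "('m \<times> 'm \<times> 'm) set"

definition shift_ftor :: "('o, 'm, 'z) tri_cat_scheme \<Rightarrow> int \<Rightarrow> ('o, 'm, 'o, 'm) ftor" where
  "shift_ftor C n = \<lparr>fobj = shO C n, farr = shA C n\<rparr>"

definition is_triangle :: "('o, 'm, 'z) tri_cat_scheme \<Rightarrow> 'm \<Rightarrow> 'm \<Rightarrow> 'm \<Rightarrow> bool" where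
  "is_triangle C u v w \<longleftrightarrow> u \<in> Arr C \<and> v \<in> Arr C \<and> w \<in> Arr C \<and>
     Cod C u = Dom C v \<and> Cod C v = Dom C w \<and> Cod C w = shO C 1 (Dom C u)"

text \<open>\<open>(a, b, e)\<close> is a morphism of triangles from \<open>(u, v, w)\<close> to \<open>(u', v', w')\<close>.\<close>

definition triangle_mor ::
  "('o, 'm, 'z) tri_cat_scheme \<Rightarrow> 'm \<times> 'm \<times> 'm \<Rightarrow> 'm \<times> 'm \<times> 'm \<Rightarrow> 'm \<Rightarrow> 'm \<Rightarrow> 'm \<Rightarrow> bool" where
  "triangle_mor C T T' a b e \<longleftrightarrow> (case T of (u, v, w) \<Rightarrow> case T' of (u', v', w') \<Rightarrow>
     a \<in> homs C (Dom C u) (Dom C u') \<and> b \<in> homs C (Dom C v) (Dom C v') \<and>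
     e \<in> homs C (Dom C w) (Dom C w') \<and>
     b \<cdot>\<^bsub>C\<^esub> u = u' \<cdot>\<^bsub>C\<^esub> a \<and> e \<cdot>\<^bsub>C\<^esub> v = v' \<cdot>\<^bsub>C\<^esub> b \<and> shA C 1 a \<cdot>\<^bsub>C\<^esub> w = w' \<cdot>\<^bsub>C\<^esub> e)"

locale triangulated_category = additive_category C
  for C :: "('o, 'm, 'z) tri_cat_scheme" (structure) +
  assumes shift_functor: "category_functor C C (shift_ftor C n)"
    and shift_Add: "\<lbrakk>f \<in> homs C A B; g \<in> homs C A B\<rbrakk>
      \<Longrightarrow> shA C n (Add C f g) = Add C (shA C n f) (shA C n g)"
    and shO_0: "A \<in> Obj C \<Longrightarrow> shO C 0 A = A"
    and shA_0: "f \<in> Arr C \<Longrightarrow> shA C 0 f = f"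
    and shO_add: "A \<in> Obj C \<Longrightarrow> shO C n (shO C m A) = shO C (m + n) A"
    and shA_add: "f \<in> Arr C \<Longrightarrow> shA C n (shA C m f) = shA C (m + n) f"
    and Tri_triangle: "(u, v, w) \<in> Tri C \<Longrightarrow> is_triangle C u v w"
    and TR1_iso: "\<lbrakk>(u, v, w) \<in> Tri C; is_triangle C u' v' w';
        triangle_mor C (u, v, w) (u', v', w') a b e; iso_arr C a; iso_arr C b; iso_arr C e\<rbrakk>
      \<Longrightarrow> (u', v', w') \<in> Tri C"
    and TR1_id: "\<lbrakk>A \<in> Obj C; is_zero_object C Z\<rbrakk>
      \<Longrightarrow> (Idn C A, Zer C A Z, Zer C Z (shO C 1 A)) \<in> Tri C"
    and TR1_cone: "u \<in> Arr C \<Longrightarrow> \<exists>v w. (u, v, w) \<in> Tri C"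
    and TR2: "is_triangle C u v w
      \<Longrightarrow> (u, v, w) \<in> Tri C \<longleftrightarrow> (v, w, neg_arr C (shA C 1 u)) \<in> Tri C"
    and TR3: "\<lbrakk>(u, v, w) \<in> Tri C; (u', v', w') \<in> Tri C; a \<in> homs C (Dom C u) (Dom C u');
        b \<in> homs C (Dom C v) (Dom C v'); b \<cdot> u = u' \<cdot> a\<rbrakk>
      \<Longrightarrow> \<exists>e. triangle_mor C (u, v, w) (u', v', w') a b e"
    and TR4: "\<lbrakk>u \<in> homs C A B; v \<in> homs C B D;
        (u, p1, d1) \<in> Tri C; (v \<cdot> u, p2, d2) \<in> Tri C; (v, p3, d3) \<in> Tri C\<rbrakk>
      \<Longrightarrow> \<exists>a b. triangle_mor C (u, p1, d1) (v \<cdot> u, p2, d2) (Idn C A) v a \<and>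
                triangle_mor C (v \<cdot> u, p2, d2) (v, p3, d3) u (Idn C D) b \<and>
                (a, b, shA C 1 p1 \<cdot> d3) \<in> Tri C"

text \<open>\<open>fsh F n A : F(A[n]) \<rightarrow> (F A)[n]\<close> is the commutation of an exact functor with the shifts.
  It is recorded for all \<open>n\<close>, subject to the cocycle rule, which makes it the extension to all
  integers of the usual datum \<open>F(A[1]) \<rightarrow> (F A)[1]\<close>.\<close>

record ('o, 'm, 'p, 'n) ex_ftor = "('o, 'm, 'p, 'n) ftor" +
  fsh :: "int \<Rightarrow> 'o \<Rightarrow> 'n"

locale exact_functor = C: triangulated_category C + D: triangulated_category D +
    category_functor C D F
  for C :: "('o, 'm, 'z) tri_cat_scheme" and D :: "('p, 'n, 'w) tri_cat_scheme"
    and F :: "('o, 'm, 'p, 'n, 'x) ex_ftor_scheme" +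
  assumes farr_Add: "\<lbrakk>f \<in> homs C A B; g \<in> homs C A B\<rbrakk>
      \<Longrightarrow> farr F (Add C f g) = Add D (farr F f) (farr F g)"
    and fsh_nat: "nat_iso C D (comp_ftor F (shift_ftor C n)) (comp_ftor (shift_ftor D n) F) (fsh F n)"
    and fsh_0: "A \<in> Obj C \<Longrightarrow> fsh F 0 A = Idn D (fobj F A)"
    and fsh_add: "A \<in> Obj C
      \<Longrightarrow> fsh F (m + n) A = shA D n (fsh F m A) \<cdot>\<^bsub>D\<^esub> fsh F n (shO C m A)"
    and farr_Tri: "(u, v, w) \<in> Tri C
      \<Longrightarrow> (farr F u, farr F v, fsh F 1 (Dom C u) \<cdot>\<^bsub>D\<^esub> farr F w) \<in> Tri D"

text \<open>Compatibility of a transformation \<open>t : F \<rightarrow> G\<close> with the shift isomorphisms.\<close>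

definition exact_trans ::
  "('o, 'm, 'z) tri_cat_scheme \<Rightarrow> ('p, 'n, 'w) tri_cat_scheme \<Rightarrow> ('o, 'm, 'p, 'n, 'x) ex_ftor_scheme
    \<Rightarrow> ('o, 'm, 'p, 'n, 'y) ex_ftor_scheme \<Rightarrow> ('o \<Rightarrow> 'n) \<Rightarrow> bool" where
  "exact_trans C D F G t \<longleftrightarrow> (\<forall>n. \<forall>A\<in>Obj C.
     fsh G n A \<cdot>\<^bsub>D\<^esub> t (shO C n A) = shA D n (t A) \<cdot>\<^bsub>D\<^esub> fsh F n A)"


section \<open>Symmetric monoidal structures\<close>

record ('o, 'm) smt_cat = "('o, 'm) tri_cat" +
  tensO :: "'o \<Rightarrow> 'o \<Rightarrow> 'o"
  tensA :: "'m \<Rightarrow> 'm \<Rightarrow> 'm"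
  unitO :: 'o
  asc :: "'o \<Rightarrow> 'o \<Rightarrow> 'o \<Rightarrow> 'm"
  lun :: "'o \<Rightarrow> 'm"
  run :: "'o \<Rightarrow> 'm"
  brd :: "'o \<Rightarrow> 'o \<Rightarrow> 'm"

text \<open>Orientation: \<open>asc A B D : (A \<otimes> B) \<otimes> D \<rightarrow> A \<otimes> (B \<otimes> D)\<close>, \<open>lun A : 1 \<otimes> A \<rightarrow> A\<close>,
  \<open>run A : A \<otimes> 1 \<rightarrow> A\<close>, \<open>brd A B : A \<otimes> B \<rightarrow> B \<otimes> A\<close>.\<close>

locale sym_monoidal_triangulated = triangulated_category C
  for C :: "('o, 'm, 'z) smt_cat_scheme" (structure) +
  assumes unitO_Obj: "unitO C \<in> Obj C"
    and tensO_Obj: "\<lbrakk>A \<in> Obj C; B \<in> Obj C\<rbrakk> \<Longrightarrow> tensO C A B \<in> Obj C"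
    and tensA_homs: "\<lbrakk>f \<in> homs C A A'; g \<in> homs C B B'\<rbrakk>
      \<Longrightarrow> tensA C f g \<in> homs C (tensO C A B) (tensO C A' B')"
    and tensA_Idn: "\<lbrakk>A \<in> Obj C; B \<in> Obj C\<rbrakk>
      \<Longrightarrow> tensA C (Idn C A) (Idn C B) = Idn C (tensO C A B)"
    and tensA_Comp: "\<lbrakk>f \<in> homs C A A'; f' \<in> homs C A' A''; g \<in> homs C B B'; g' \<in> homs C B' B''\<rbrakk>
      \<Longrightarrow> tensA C (f' \<cdot> f) (g' \<cdot> g) = tensA C f' g' \<cdot> tensA C f g"
    and asc_homs: "\<lbrakk>A \<in> Obj C; B \<in> Obj C; D \<in> Obj C\<rbrakk> \<Longrightarrow>
      asc C A B D \<in> homs C (tensO C (tensO C A B) D) (tensO C A (tensO C B D))"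
    and asc_iso: "\<lbrakk>A \<in> Obj C; B \<in> Obj C; D \<in> Obj C\<rbrakk> \<Longrightarrow> iso_arr C (asc C A B D)"
    and asc_nat: "\<lbrakk>f \<in> homs C A A'; g \<in> homs C B B'; h \<in> homs C D D'\<rbrakk> \<Longrightarrow>
      asc C A' B' D' \<cdot> tensA C (tensA C f g) h = tensA C f (tensA C g h) \<cdot> asc C A B D"
    and lun_homs: "A \<in> Obj C \<Longrightarrow> lun C A \<in> homs C (tensO C (unitO C) A) A"
    and lun_iso: "A \<in> Obj C \<Longrightarrow> iso_arr C (lun C A)"
    and lun_nat: "f \<in> homs C A B \<Longrightarrow> lun C B \<cdot> tensA C (Idn C (unitO C)) f = f \<cdot> lun C A"
    and run_homs: "A \<in> Obj C \<Longrightarrow> run C A \<in> homs C (tensO C A (unitO C)) A"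
    and run_iso: "A \<in> Obj C \<Longrightarrow> iso_arr C (run C A)"
    and run_nat: "f \<in> homs C A B \<Longrightarrow> run C B \<cdot> tensA C f (Idn C (unitO C)) = f \<cdot> run C A"
    and brd_homs: "\<lbrakk>A \<in> Obj C; B \<in> Obj C\<rbrakk> \<Longrightarrow> brd C A B \<in> homs C (tensO C A B) (tensO C B A)"
    and brd_nat: "\<lbrakk>f \<in> homs C A A'; g \<in> homs C B B'\<rbrakk> \<Longrightarrow>
      brd C A' B' \<cdot> tensA C f g = tensA C g f \<cdot> brd C A B"
    and pentagon: "\<lbrakk>A \<in> Obj C; B \<in> Obj C; D \<in> Obj C; E \<in> Obj C\<rbrakk> \<Longrightarrow>
      asc C A B (tensO C D E) \<cdot> asc C (tensO C A B) D E =
      tensA C (Idn C A) (asc C B D E) \<cdot> asc C A (tensO C B D) E \<cdot> tensA C (asc C A B D) (Idn C E)"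
    and unit_triangle: "\<lbrakk>A \<in> Obj C; B \<in> Obj C\<rbrakk> \<Longrightarrow>
      tensA C (Idn C A) (lun C B) \<cdot> asc C A (unitO C) B = tensA C (run C A) (Idn C B)"
    and hexagon: "\<lbrakk>A \<in> Obj C; B \<in> Obj C; D \<in> Obj C\<rbrakk> \<Longrightarrow>
      asc C B D A \<cdot> brd C A (tensO C B D) \<cdot> asc C A B D =
      tensA C (Idn C B) (brd C A D) \<cdot> asc C B A D \<cdot> tensA C (brd C A B) (Idn C D)"
    and symmetry: "\<lbrakk>A \<in> Obj C; B \<in> Obj C\<rbrakk> \<Longrightarrow> brd C B A \<cdot> brd C A B = Idn C (tensO C A B)"

text \<open>Structure maps of a strong symmetric monoidal functor:
  \<open>fmu F A B : F A \<otimes> F B \<rightarrow> F (A \<otimes> B)\<close> and \<open>fun1 F : 1 \<rightarrow> F 1\<close>.\<close>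

record ('o, 'm, 'p, 'n) sme_ftor = "('o, 'm, 'p, 'n) ex_ftor" +
  fmu :: "'o \<Rightarrow> 'o \<Rightarrow> 'n"
  fun1 :: 'n

locale sym_monoidal_exact_functor =
    C: sym_monoidal_triangulated C + D: sym_monoidal_triangulated D + exact_functor C D F
  for C :: "('o, 'm, 'z) smt_cat_scheme" and D :: "('p, 'n, 'w) smt_cat_scheme"
    and F :: "('o, 'm, 'p, 'n, 'x) sme_ftor_scheme" +
  assumes fun1_homs: "fun1 F \<in> homs D (unitO D) (fobj F (unitO C))"
    and fun1_iso: "iso_arr D (fun1 F)"
    and fmu_homs: "\<lbrakk>A \<in> Obj C; B \<in> Obj C\<rbrakk> \<Longrightarrow>
      fmu F A B \<in> homs D (tensO D (fobj F A) (fobj F B)) (fobj F (tensO C A B))"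
    and fmu_iso: "\<lbrakk>A \<in> Obj C; B \<in> Obj C\<rbrakk> \<Longrightarrow> iso_arr D (fmu F A B)"
    and fmu_nat: "\<lbrakk>f \<in> homs C A A'; g \<in> homs C B B'\<rbrakk> \<Longrightarrow>
      fmu F A' B' \<cdot>\<^bsub>D\<^esub> tensA D (farr F f) (farr F g) = farr F (tensA C f g) \<cdot>\<^bsub>D\<^esub> fmu F A B"
    and fmu_asc: "\<lbrakk>A \<in> Obj C; B \<in> Obj C; E \<in> Obj C\<rbrakk> \<Longrightarrow>
      farr F (asc C A B E) \<cdot>\<^bsub>D\<^esub> fmu F (tensO C A B) E \<cdot>\<^bsub>D\<^esub> tensA D (fmu F A B) (Idn D (fobj F E)) =
      fmu F A (tensO C B E) \<cdot>\<^bsub>D\<^esub> tensA D (Idn D (fobj F A)) (fmu F B E)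
        \<cdot>\<^bsub>D\<^esub> asc D (fobj F A) (fobj F B) (fobj F E)"
    and fmu_lun: "A \<in> Obj C \<Longrightarrow>
      farr F (lun C A) \<cdot>\<^bsub>D\<^esub> fmu F (unitO C) A \<cdot>\<^bsub>D\<^esub> tensA D (fun1 F) (Idn D (fobj F A)) =
      lun D (fobj F A)"
    and fmu_run: "A \<in> Obj C \<Longrightarrow>
      farr F (run C A) \<cdot>\<^bsub>D\<^esub> fmu F A (unitO C) \<cdot>\<^bsub>D\<^esub> tensA D (Idn D (fobj F A)) (fun1 F) =
      run D (fobj F A)"
    and fmu_brd: "\<lbrakk>A \<in> Obj C; B \<in> Obj C\<rbrakk> \<Longrightarrow>
      farr F (brd C A B) \<cdot>\<^bsub>D\<^esub> fmu F A B = fmu F B A \<cdot>\<^bsub>D\<^esub> brd D (fobj F A) (fobj F B)"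

definition monoidal_trans ::
  "('o, 'm, 'z) smt_cat_scheme \<Rightarrow> ('p, 'n, 'w) smt_cat_scheme \<Rightarrow> ('o, 'm, 'p, 'n, 'x) sme_ftor_scheme
    \<Rightarrow> ('o, 'm, 'p, 'n, 'y) sme_ftor_scheme \<Rightarrow> ('o \<Rightarrow> 'n) \<Rightarrow> bool" where
  "monoidal_trans C D F G t \<longleftrightarrow>
     t (unitO C) \<cdot>\<^bsub>D\<^esub> fun1 F = fun1 G \<and>
     (\<forall>A\<in>Obj C. \<forall>B\<in>Obj C.
        t (tensO C A B) \<cdot>\<^bsub>D\<^esub> fmu F A B = fmu G A B \<cdot>\<^bsub>D\<^esub> tensA D (t A) (t B))"

text \<open>Composite \<open>G \<circ> F\<close> with its induced structure; \<open>E\<close> is the target category of \<open>G\<close>.\<close>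

definition comp_sme ::
  "('q, 'k, 'z) cat_scheme \<Rightarrow> ('p, 'n, 'q, 'k) sme_ftor \<Rightarrow> ('o, 'm, 'p, 'n) sme_ftor
    \<Rightarrow> ('o, 'm, 'q, 'k) sme_ftor" where
  "comp_sme E G F = \<lparr>
     fobj = \<lambda>A. fobj G (fobj F A),
     farr = \<lambda>f. farr G (farr F f),
     fsh = \<lambda>n A. fsh G n (fobj F A) \<cdot>\<^bsub>E\<^esub> farr G (fsh F n A),
     fmu = \<lambda>A B. farr G (fmu F A B) \<cdot>\<^bsub>E\<^esub> fmu G (fobj F A) (fobj F B),
     fun1 = farr G (fun1 F) \<cdot>\<^bsub>E\<^esub> fun1 G\<rparr>"


section \<open>Coefficient systems on spaces\<close>

text \<open>Closed immersions, and which morphism is the open complement of which closed immersion, are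
  part of the structure of the category of spaces.\<close>

record ('s, 'f) space_cat = "('s, 'f) cat" +
  closed_immersions :: "'f set"
  open_complement :: "'f \<Rightarrow> 'f \<Rightarrow> bool"

locale spaces = category P for P :: "('s, 'f, 'z) space_cat_scheme" (structure) +
  assumes closed_immersions_Arr: "closed_immersions P \<subseteq> Arr P"
    and open_complement_closed: "open_complement P i j \<Longrightarrow> i \<in> closed_immersions P"
    and open_complement_Arr: "open_complement P i j \<Longrightarrow> j \<in> Arr P \<and> Cod P j = Cod P i"

text \<open>For \<open>f : X \<rightarrow> Y\<close>: \<open>pull S f = f\<^sup>*\<close>, \<open>push S f = f\<^sub>*\<close>, with unit \<open>unt S f : id \<rightarrow> f\<^sub>* f\<^sup>*\<close> and counit
  \<open>cnt S f : f\<^sup>* f\<^sub>* \<rightarrow> id\<close>. For composable \<open>f\<close>, \<open>g\<close>, \<open>pcomp S g f : (g \<circ> f)\<^sup>* \<rightarrow> f\<^sup>* g\<^sup>*\<close>.\<close>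

record ('s, 'f, 'o, 'm) coeff =
  spc :: "('s, 'f) space_cat"
  coef :: "'s \<Rightarrow> ('o, 'm) smt_cat"
  pull :: "'f \<Rightarrow> ('o, 'm, 'o, 'm) sme_ftor"
  push :: "'f \<Rightarrow> ('o, 'm, 'o, 'm) ex_ftor"
  unt :: "'f \<Rightarrow> 'o \<Rightarrow> 'm"
  cnt :: "'f \<Rightarrow> 'o \<Rightarrow> 'm"
  pcomp :: "'f \<Rightarrow> 'f \<Rightarrow> 'o \<Rightarrow> 'm"

text \<open>\<open>pcomp\<close> consists of isomorphisms of symmetric monoidal exact functors. Further coherence
  (triple composites, identities) is not imposed, as no canonical map below involves it.\<close>

locale coefficient_system =
  fixes S :: "('s, 'f, 'o, 'm) coeff"
  assumes spaces: "spaces (spc S)"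
    and coef_category: "X \<in> Obj (spc S) \<Longrightarrow> sym_monoidal_triangulated (coef S X)"
    and pull_functor: "f \<in> homs (spc S) X Y
      \<Longrightarrow> sym_monoidal_exact_functor (coef S Y) (coef S X) (pull S f)"
    and push_functor: "f \<in> homs (spc S) X Y \<Longrightarrow> exact_functor (coef S X) (coef S Y) (push S f)"
    and pull_push_adj: "f \<in> homs (spc S) X Y
      \<Longrightarrow> adjunction (coef S Y) (coef S X) (pull S f) (push S f) (unt S f) (cnt S f)"
    and pcomp_iso: "\<lbrakk>f \<in> homs (spc S) X Y; g \<in> homs (spc S) Y W\<rbrakk> \<Longrightarrow>
      nat_iso (coef S W) (coef S X) (pull S (g \<cdot>\<^bsub>spc S\<^esub> f)) (comp_sme (coef S X) (pull S f) (pull S g))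
        (pcomp S g f)"
    and pcomp_exact: "\<lbrakk>f \<in> homs (spc S) X Y; g \<in> homs (spc S) Y W\<rbrakk> \<Longrightarrow>
      exact_trans (coef S W) (coef S X) (pull S (g \<cdot>\<^bsub>spc S\<^esub> f)) (comp_sme (coef S X) (pull S f) (pull S g))
        (pcomp S g f)"
    and pcomp_monoidal: "\<lbrakk>f \<in> homs (spc S) X Y; g \<in> homs (spc S) Y W\<rbrakk> \<Longrightarrow>
      monoidal_trans (coef S W) (coef S X) (pull S (g \<cdot>\<^bsub>spc S\<^esub> f)) (comp_sme (coef S X) (pull S f) (pull S g))
        (pcomp S g f)"


section \<open>Recollements\<close>

text \<open>For \<open>i : Z \<rightarrow> X\<close> and \<open>j : U \<rightarrow> X\<close>: \<open>i\<^sup>!\<close>, \<open>j\<^sub>!\<close>, the units and counits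
  \<open>id \<rightarrow> i\<^sup>! i\<^sub>*\<close>, \<open>i\<^sub>* i\<^sup>! \<rightarrow> id\<close>, \<open>id \<rightarrow> j\<^sup>* j\<^sub>!\<close>, \<open>j\<^sub>! j\<^sup>* \<rightarrow> id\<close>, and the connecting morphisms
  \<open>i\<^sub>* i\<^sup>* M \<rightarrow> (j\<^sub>! j\<^sup>* M)[1]\<close> and \<open>j\<^sub>* j\<^sup>* M \<rightarrow> (i\<^sub>* i\<^sup>! M)[1]\<close>. The remaining data belong to the
  coefficient system.\<close>

record ('o, 'm) recoll =
  ishriek :: "('o, 'm, 'o, 'm) ftor"
  jshriek :: "('o, 'm, 'o, 'm) ftor"
  iunit :: "'o \<Rightarrow> 'm"
  icounit :: "'o \<Rightarrow> 'm"
  junit :: "'o \<Rightarrow> 'm"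
  jcounit :: "'o \<Rightarrow> 'm"
  conn1 :: "'o \<Rightarrow> 'm"
  conn2 :: "'o \<Rightarrow> 'm"

locale recollement =
  fixes S :: "('s, 'f, 'o, 'm) coeff" and i j :: 'f and R :: "('o, 'm) recoll"
    and CX CZ CU :: "('o, 'm) smt_cat"
  defines "CX \<equiv> coef S (Cod (spc S) i)"
    and "CZ \<equiv> coef S (Dom (spc S) i)"
    and "CU \<equiv> coef S (Dom (spc S) j)"
  assumes ishriek_adj: "adjunction CZ CX (push S i) (ishriek R) (iunit R) (icounit R)"
    and jshriek_adj: "adjunction CU CX (jshriek R) (pull S j) (junit R) (jcounit R)"
    and push_i_ff: "fully_faithful CZ CX (push S i)"
    and jshriek_ff: "fully_faithful CU CX (jshriek R)"
    and pull_j_push_i: "B \<in> Obj CZ \<Longrightarrow> is_zero_object CU (fobj (pull S j) (fobj (push S i) B))"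
    and pull_i_jshriek: "B \<in> Obj CU \<Longrightarrow> is_zero_object CZ (fobj (pull S i) (fobj (jshriek R) B))"
    and conn1_nat: "nat_trans CX CX (comp_ftor (push S i) (pull S i))
      (comp_ftor (shift_ftor CX 1) (comp_ftor (jshriek R) (pull S j))) (conn1 R)"
    and conn2_nat: "nat_trans CX CX (comp_ftor (push S j) (pull S j))
      (comp_ftor (shift_ftor CX 1) (comp_ftor (push S i) (ishriek R))) (conn2 R)"
    and triangle1: "M \<in> Obj CX \<Longrightarrow> (jcounit R M, unt S i M, conn1 R M) \<in> Tri CX"
    and triangle2: "M \<in> Obj CX \<Longrightarrow> (icounit R M, unt S j M, conn2 R M) \<in> Tri CX"


section \<open>Beck--Chevalley morphisms\<close>

text \<open>For a commutative square \<open>f \<circ> h' = h \<circ> f'\<close>, the isomorphism \<open>f'\<^sup>* h\<^sup>* M \<rightarrow> h'\<^sup>* f\<^sup>* M\<close>.\<close>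

definition square_iso :: "('s, 'f, 'o, 'm) coeff \<Rightarrow> 'f \<Rightarrow> 'f \<Rightarrow> 'f \<Rightarrow> 'f \<Rightarrow> 'o \<Rightarrow> 'm" where
  "square_iso S f h' h f' M = (let C = coef S (Dom (spc S) f') in
     pcomp S f h' M \<cdot>\<^bsub>C\<^esub> inv_arr C (pcomp S h f' M))"

text \<open>\<open>g\<^sup>* i\<^sub>* B \<rightarrow> i'\<^sub>* i'\<^sup>* g\<^sup>* i\<^sub>* B \<rightarrow> i'\<^sub>* g\<^sub>Z\<^sup>* i\<^sup>* i\<^sub>* B \<rightarrow> i'\<^sub>* g\<^sub>Z\<^sup>* B\<close>\<close>

definition exch_push :: "('s, 'f, 'o, 'm) coeff \<Rightarrow> 'f \<Rightarrow> 'f \<Rightarrow> 'f \<Rightarrow> 'f \<Rightarrow> 'o \<Rightarrow> 'm" where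
  "exch_push S i gZ g i' B = (let C = coef S (Cod (spc S) i') in
     farr (push S i') (farr (pull S gZ) (cnt S i B)) \<cdot>\<^bsub>C\<^esub>
     farr (push S i') (square_iso S i gZ g i' (fobj (push S i) B)) \<cdot>\<^bsub>C\<^esub>
     unt S i' (fobj (pull S g) (fobj (push S i) B)))"

text \<open>\<open>g\<^sub>Z\<^sup>* i\<^sup>! A \<rightarrow> i'\<^sup>! i'\<^sub>* g\<^sub>Z\<^sup>* i\<^sup>! A \<rightarrow> i'\<^sup>! g\<^sup>* i\<^sub>* i\<^sup>! A \<rightarrow> i'\<^sup>! g\<^sup>* A\<close>, where the middle map inverts
  \<open>exch_push\<close>.\<close>

definition exch_shriek ::
  "('s, 'f, 'o, 'm) coeff \<Rightarrow> ('o, 'm) recoll \<Rightarrow> ('o, 'm) recoll \<Rightarrow> 'f \<Rightarrow> 'f \<Rightarrow> 'f \<Rightarrow> 'f \<Rightarrow> 'o \<Rightarrow> 'm" where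
  "exch_shriek S R R' i gZ g i' A = (let C = coef S (Dom (spc S) i') in
     farr (ishriek R') (farr (pull S g) (icounit R A)) \<cdot>\<^bsub>C\<^esub>
     farr (ishriek R') (inv_arr (coef S (Cod (spc S) i')) (exch_push S i gZ g i' (fobj (ishriek R) A))) \<cdot>\<^bsub>C\<^esub>
     iunit R' (fobj (pull S gZ) (fobj (ishriek R) A)))"

definition beck_chevalley_closed ::
  "('s, 'f, 'o, 'm) coeff \<Rightarrow> ('o, 'm) recoll \<Rightarrow> ('o, 'm) recoll \<Rightarrow> 'f \<Rightarrow> 'f \<Rightarrow> 'f \<Rightarrow> 'f \<Rightarrow> bool" where
  "beck_chevalley_closed S R R' i gZ g i' \<longleftrightarrow>
     (\<forall>B\<in>Obj (coef S (Dom (spc S) i)). iso_arr (coef S (Cod (spc S) i')) (exch_push S i gZ g i' B)) \<and>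
     (\<forall>A\<in>Obj (coef S (Cod (spc S) i)). iso_arr (coef S (Dom (spc S) i')) (exch_shriek S R R' i gZ g i' A))"

definition beck_chevalley_open ::
  "('s, 'f, 'o, 'm) coeff \<Rightarrow> 'f \<Rightarrow> 'f \<Rightarrow> 'f \<Rightarrow> 'f \<Rightarrow> bool" where
  "beck_chevalley_open S j gU g j' \<longleftrightarrow>
     (\<forall>A\<in>Obj (coef S (Cod (spc S) j)). iso_arr (coef S (Dom (spc S) j')) (square_iso S j gU g j' A))"


section \<open>Cohomology and localization torsors\<close>

definition cohom :: "('s, 'f, 'o, 'm) coeff \<Rightarrow> 's \<Rightarrow> int \<Rightarrow> 'o \<Rightarrow> 'm monoid" where
  "cohom S X d A = hom_group (coef S X) (unitO (coef S X)) (shO (coef S X) d A)"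

text \<open>\<open>f\<^sup>* c : 1 \<rightarrow> f\<^sup>* 1 \<rightarrow> f\<^sup>*(A[d]) \<rightarrow> (f\<^sup>* A)[d]\<close>\<close>

definition pull_class :: "('s, 'f, 'o, 'm) coeff \<Rightarrow> 'f \<Rightarrow> int \<Rightarrow> 'o \<Rightarrow> 'm \<Rightarrow> 'm" where
  "pull_class S f d A c = (let C = coef S (Dom (spc S) f) in
     fsh (pull S f) d A \<cdot>\<^bsub>C\<^esub> farr (pull S f) c \<cdot>\<^bsub>C\<^esub> fun1 (pull S f))"

definition cohom_supp ::
  "('s, 'f, 'o, 'm) coeff \<Rightarrow> ('o, 'm) recoll \<Rightarrow> 'f \<Rightarrow> int \<Rightarrow> 'o \<Rightarrow> 'm monoid" where
  "cohom_supp S R i d A = cohom S (Cod (spc S) i) d (fobj (push S i) (fobj (ishriek R) A))"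

definition forg ::
  "('s, 'f, 'o, 'm) coeff \<Rightarrow> ('o, 'm) recoll \<Rightarrow> 'f \<Rightarrow> int \<Rightarrow> 'o \<Rightarrow> 'm \<Rightarrow> 'm" where
  "forg S R i d A t = (let C = coef S (Cod (spc S) i) in shA C d (icounit R A) \<cdot>\<^bsub>C\<^esub> t)"

definition Lift ::
  "('s, 'f, 'o, 'm) coeff \<Rightarrow> ('o, 'm) recoll \<Rightarrow> 'f \<Rightarrow> int \<Rightarrow> 'o \<Rightarrow> 'm \<Rightarrow> 'm set" where
  "Lift S R i d A c = {t \<in> carrier (cohom_supp S R i d A). forg S R i d A t = c}"

text \<open>The adjunction map \<open>Hom(1, (i\<^sub>* i\<^sup>! A)[d]) \<rightarrow> Hom(1, (i\<^sup>! A)[d])\<close>, sending \<open>t\<close> to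
  \<open>1 \<rightarrow> i\<^sup>* 1 \<rightarrow> i\<^sup>*((i\<^sub>* i\<^sup>! A)[d]) \<rightarrow> (i\<^sup>* i\<^sub>* i\<^sup>! A)[d] \<rightarrow> (i\<^sup>! A)[d]\<close>.\<close>

definition supp_adj ::
  "('s, 'f, 'o, 'm) coeff \<Rightarrow> ('o, 'm) recoll \<Rightarrow> 'f \<Rightarrow> int \<Rightarrow> 'o \<Rightarrow> 'm \<Rightarrow> 'm" where
  "supp_adj S R i d A t = (let C = coef S (Dom (spc S) i) in
     shA C d (cnt S i (fobj (ishriek R) A)) \<cdot>\<^bsub>C\<^esub>
     pull_class S i d (fobj (push S i) (fobj (ishriek R) A)) t)"

definition Loc_tor ::
  "('s, 'f, 'o, 'm) coeff \<Rightarrow> ('o, 'm) recoll \<Rightarrow> 'f \<Rightarrow> int \<Rightarrow> 'o \<Rightarrow> 'm \<Rightarrow> 'm set" where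
  "Loc_tor S R i d A c = supp_adj S R i d A ` Lift S R i d A c"

text \<open>The image of \<open>ker forg\<close> under the adjunction map, as a subgroup of \<open>H\<^sup>d(Z; i\<^sup>! A)\<close>.\<close>

definition Loc_group ::
  "('s, 'f, 'o, 'm) coeff \<Rightarrow> ('o, 'm) recoll \<Rightarrow> 'f \<Rightarrow> int \<Rightarrow> 'o \<Rightarrow> 'm monoid" where
  "Loc_group S R i d A = (cohom S (Dom (spc S) i) d (fobj (ishriek R) A))
     \<lparr>carrier := supp_adj S R i d A `
        kernel (cohom_supp S R i d A) (cohom S (Cod (spc S) i) d A) (forg S R i d A)\<rparr>"

definition Loc_act ::
  "('s, 'f, 'o, 'm) coeff \<Rightarrow> ('o, 'm) recoll \<Rightarrow> 'f \<Rightarrow> int \<Rightarrow> 'o \<Rightarrow> 'm \<Rightarrow> 'm \<Rightarrow> 'm \<Rightarrow> 'm" where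
  "Loc_act S R i d A c = (\<lambda>k. \<lambda>s\<in>Loc_tor S R i d A c. k \<otimes>\<^bsub>Loc_group S R i d A\<^esub> s)"

text \<open>\<open>H\<^sup>d(Z; i\<^sup>! A) \<rightarrow> H\<^sup>d(Z'; g\<^sub>Z\<^sup>* i\<^sup>! A) \<cong> H\<^sup>d(Z'; i'\<^sup>! g\<^sup>* A)\<close>\<close>

definition Loc_pull ::
  "('s, 'f, 'o, 'm) coeff \<Rightarrow> ('o, 'm) recoll \<Rightarrow> ('o, 'm) recoll \<Rightarrow> 'f \<Rightarrow> 'f \<Rightarrow> 'f \<Rightarrow> 'f
    \<Rightarrow> int \<Rightarrow> 'o \<Rightarrow> 'm \<Rightarrow> 'm" where
  "Loc_pull S R R' i gZ g i' d A s = (let C = coef S (Dom (spc S) i') in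
     shA C d (exch_shriek S R R' i gZ g i' A) \<cdot>\<^bsub>C\<^esub> pull_class S gZ d (fobj (ishriek R) A) s)"

definition torsor :: "('g, 'y) monoid_scheme \<Rightarrow> 'e set \<Rightarrow> ('g \<Rightarrow> 'e \<Rightarrow> 'e) \<Rightarrow> bool" where
  "torsor G E \<phi> \<longleftrightarrow> group_action G E \<phi> \<and> E \<noteq> {} \<and>
     (\<forall>x\<in>E. \<forall>y\<in>E. \<exists>!g. g \<in> carrier G \<and> \<phi> g x = y)"

definition torsor_morphism ::
  "('g, 'y) monoid_scheme \<Rightarrow> 'e set \<Rightarrow> ('g \<Rightarrow> 'e \<Rightarrow> 'e) \<Rightarrow>
   ('h, 'z) monoid_scheme \<Rightarrow> 'k set \<Rightarrow> ('h \<Rightarrow> 'k \<Rightarrow> 'k) \<Rightarrow> ('g \<Rightarrow> 'h) \<Rightarrow> ('e \<Rightarrow> 'k) \<Rightarrow> bool" where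
  "torsor_morphism G E \<phi> H K \<psi> \<theta> f \<longleftrightarrow> torsor G E \<phi> \<and> torsor H K \<psi> \<and>
     \<theta> \<in> hom G H \<and> f \<in> E \<rightarrow> K \<and>
     (\<forall>g\<in>carrier G. \<forall>x\<in>E. f (\<phi> g x) = \<psi> (\<theta> g) (f x))"

end

theory Submission
  imports Defs
begin

text \<open>A lift \<open>t : 1 \<rightarrow> (i\<^sub>* i\<^sup>! A)[d]\<close> of \<open>c\<close> is sent to the composite of \<open>g\<^sup>* t\<close> with
  \<open>g\<^sup>* i\<^sub>* i\<^sup>! A \<rightarrow> i'\<^sub>* g\<^sub>Z\<^sup>* i\<^sup>! A \<rightarrow> i'\<^sub>* i'\<^sup>! g\<^sup>* A\<close>. Each exchange morphism is by construction the transpose of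
  a simpler map, so this transformation is compatible with the counits of \<open>i\<^sub>* \<stileturn> i\<^sup>!\<close> and \<open>i'\<^sub>* \<stileturn> i'\<^sup>!\<close>, hence
  the result lifts \<open>g\<^sup>* c\<close>; and it is compatible with the counits of \<open>i\<^sup>* \<stileturn> i\<^sub>*\<close> and \<open>i'\<^sup>* \<stileturn> i'\<^sub>*\<close>, hence its
  adjoint is the pullback of the adjoint of \<open>t\<close>. Applied to \<open>c = 0\<close>, the same argument gives the homomorphism
  between the acting groups. Lifts exist because representable functors are exact on the localization
  triangle.\<close>

section \<open>Categories and adjunctions\<close>

lemma (in category) homs_Obj:
  assumes "f \<in> homs C A B"
  shows "A \<in> Obj C" "B \<in> Obj C"
  using assms Dom_Obj Cod_Obj by (auto simp: homs_def)

text \<open>\<open>inv_arr\<close> is a definite description, so uniqueness of two-sided inverses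
  has to come first; after that its defining equations can be read off.\<close>

lemma (in category) inv_arr_iso:
  assumes iso: "iso_arr C f" and f: "f \<in> homs C A B"
  shows "inv_arr C f \<in> homs C B A" "inv_arr C f \<cdot> f = Idn C A" "f \<cdot> inv_arr C f = Idn C B"
proof -
  obtain h where h: "inverse_arrs C f h"
    using iso by (auto simp: iso_arr_def)
  have "k = h" if k: "inverse_arrs C f k" for k
  proof -
    have hk: "h \<in> homs C B A" "k \<in> homs C B A" "k \<cdot> f = Idn C A" "f \<cdot> h = Idn C B"
      using f h k by (auto simp: inverse_arrs_def homs_def)
    have "k = k \<cdot> (f \<cdot> h)"
      using Idn_right[OF hk(2)] hk(4) by simp
    also have "\<dots> = (k \<cdot> f) \<cdot> h"
      using Comp_assoc[OF hk(1) f hk(2)] by simp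
    finally show ?thesis
      using Idn_left[OF hk(1)] hk(3) by simp
  qed
  then have "inverse_arrs C f (inv_arr C f)"
    unfolding inv_arr_def using h by (rule theI[rotated])
  then show "inv_arr C f \<in> homs C B A" "inv_arr C f \<cdot> f = Idn C A" "f \<cdot> inv_arr C f = Idn C B"
    using f by (auto simp: inverse_arrs_def homs_def)
qed

lemma (in category) iso_cancel_left:
  assumes "iso_arr C h" "h \<in> homs C B D" "f \<in> homs C A B" "f' \<in> homs C A B" "h \<cdot> f = h \<cdot> f'"
  shows "f = f'"
proof -
  note inv = inv_arr_iso[OF assms(1,2)]
  have "(inv_arr C h \<cdot> h) \<cdot> f = (inv_arr C h \<cdot> h) \<cdot> f'"
    using Comp_assoc[OF assms(3,2) inv(1)] Comp_assoc[OF assms(4,2) inv(1)] assms(5) by simp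
  then show ?thesis
    using Idn_left[OF assms(3)] Idn_left[OF assms(4)] inv(2) by simp
qed

lemma (in category) iso_cancel_right:
  assumes "iso_arr C h" "h \<in> homs C A B" "f \<in> homs C B D" "f' \<in> homs C B D" "f \<cdot> h = f' \<cdot> h"
  shows "f = f'"
proof -
  note inv = inv_arr_iso[OF assms(1,2)]
  have "f \<cdot> (h \<cdot> inv_arr C h) = f' \<cdot> (h \<cdot> inv_arr C h)"
    using Comp_assoc[OF inv(1) assms(2,3)] Comp_assoc[OF inv(1) assms(2,4)] assms(5) by simp
  then show ?thesis
    using Idn_right[OF assms(3)] Idn_right[OF assms(4)] inv(3) by simp
qed

lemma nat_trans_square:
  assumes "nat_trans C D F G t" "f \<in> homs C A B"
  shows "t B \<cdot>\<^bsub>D\<^esub> farr F f = farr G f \<cdot>\<^bsub>D\<^esub> t A"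
  using assms by (auto simp: nat_trans_def homs_def)

section \<open>Transposition along an adjunction\<close>

context adjunction
begin

lemma unit_homs: "A \<in> Obj C \<Longrightarrow> \<eta> A \<in> homs C A (fobj G (fobj F A))"
  using unit_nat by (simp add: nat_trans_def id_ftor_def comp_ftor_def)

lemma counit_homs: "B \<in> Obj D \<Longrightarrow> \<epsilon> B \<in> homs D (fobj F (fobj G B)) B"
  using counit_nat by (simp add: nat_trans_def id_ftor_def comp_ftor_def)

lemma counit_square: "f \<in> homs D A B \<Longrightarrow> \<epsilon> B \<cdot>\<^bsub>D\<^esub> farr F (farr G f) = f \<cdot>\<^bsub>D\<^esub> \<epsilon> A"
  using nat_trans_square[OF counit_nat] by (simp add: id_ftor_def comp_ftor_def)

lemma unit_square: "f \<in> homs C A B \<Longrightarrow> \<eta> B \<cdot>\<^bsub>C\<^esub> f = farr G (farr F f) \<cdot>\<^bsub>C\<^esub> \<eta> A"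
  using nat_trans_square[OF unit_nat] by (simp add: id_ftor_def comp_ftor_def)

text \<open>Naturality of the counit moves \<open>h\<close> to the front, and the first triangle
  identity removes the rest. The exchange morphisms are transposes of exactly this shape, so this
  one computation serves both \<open>i'\<^sup>* \<stileturn> i'\<^sub>*\<close> and
  \<open>i'\<^sub>* \<stileturn> i'\<^sup>!\<close>.\<close>

lemma counit_transpose:
  assumes A: "A \<in> Obj C" and h: "h \<in> homs D (fobj F A) B"
  shows "\<epsilon> B \<cdot>\<^bsub>D\<^esub> farr F (farr G h \<cdot>\<^bsub>C\<^esub> \<eta> A) = h"
proof -
  note hs = F.farr_homs[OF unit_homs[OF A]] F.farr_homs[OF G.farr_homs[OF h]]
    counit_homs[OF F.D.homs_Obj(2)[OF h]] counit_homs[OF F.fobj_Obj[OF A]]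
  have "\<epsilon> B \<cdot>\<^bsub>D\<^esub> farr F (farr G h \<cdot>\<^bsub>C\<^esub> \<eta> A) = (\<epsilon> B \<cdot>\<^bsub>D\<^esub> farr F (farr G h)) \<cdot>\<^bsub>D\<^esub> farr F (\<eta> A)"
    using F.farr_Comp[OF unit_homs[OF A] G.farr_homs[OF h]] F.D.Comp_assoc[OF hs(1-3)] by simp
  also have "\<dots> = h \<cdot>\<^bsub>D\<^esub> (\<epsilon> (fobj F A) \<cdot>\<^bsub>D\<^esub> farr F (\<eta> A))"
    using counit_square[OF h] F.D.Comp_assoc[OF hs(1,4) h] by simp
  finally show ?thesis
    using triangle_left[OF A] F.D.Idn_right[OF h] by simp
qed

text \<open>Naturality of the unit and the second triangle identity. The point is that
  \<open>f\<close> is recovered from \<open>farr F f\<close>, so for additive functors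
  \<open>f\<close> vanishes as soon as \<open>farr F f\<close> does.\<close>

lemma transpose_counit:
  assumes B: "B \<in> Obj D" and f: "f \<in> homs C A (fobj G B)"
  shows "farr G (\<epsilon> B) \<cdot>\<^bsub>C\<^esub> farr G (farr F f) \<cdot>\<^bsub>C\<^esub> \<eta> A = f"
proof -
  note hs = unit_homs[OF G.fobj_Obj[OF B]] G.farr_homs[OF counit_homs[OF B]]
  have "farr G (\<epsilon> B) \<cdot>\<^bsub>C\<^esub> farr G (farr F f) \<cdot>\<^bsub>C\<^esub> \<eta> A = (farr G (\<epsilon> B) \<cdot>\<^bsub>C\<^esub> \<eta> (fobj G B)) \<cdot>\<^bsub>C\<^esub> f"
    using unit_square[OF f] F.C.Comp_assoc[OF f hs] by simp
  then show ?thesis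
    using triangle_right[OF B] F.C.Idn_left[OF f] by simp
qed

end

section \<open>Additive and triangulated categories\<close>

context additive_category
begin

lemma Zer_homs: "\<lbrakk>A \<in> Obj C; B \<in> Obj C\<rbrakk> \<Longrightarrow> Zer C A B \<in> homs C A B"
  using monoid.one_closed[of "hom_group C A B"] hom_comm_group[of A B]
  by (simp add: hom_group_def comm_group_def group_def)

text \<open>A group has only one idempotent. Zero maps are thereby preserved by every operation
  compatible with \<open>Add\<close>: composition, shifts and exact functors.\<close>

lemma Zer_if_idem:
  assumes f: "f \<in> homs C A B" and "Add C f f = f"
  shows "f = Zer C A B"
proof -
  interpret comm_group "hom_group C A B"
    using hom_comm_group homs_Obj[OF f] by blast
  show ?thesis
    using l_cancel_one'[of f f] assms by (simp add: hom_group_def)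
qed

lemma Zer_idem: "\<lbrakk>A \<in> Obj C; B \<in> Obj C\<rbrakk> \<Longrightarrow> Add C (Zer C A B) (Zer C A B) = Zer C A B"
  using monoid.l_one[of "hom_group C A B" "Zer C A B"] hom_comm_group[of A B] Zer_homs[of A B]
  by (simp add: hom_group_def comm_group_def group_def)

lemma Comp_Zer_right:
  assumes A: "A \<in> Obj C" and h: "h \<in> homs C B D"
  shows "h \<cdot> Zer C A B = Zer C A D"
proof (rule Zer_if_idem)
  note z = Zer_homs[OF A homs_Obj(1)[OF h]]
  show "h \<cdot> Zer C A B \<in> homs C A D"
    by (rule Comp_homs[OF z h])
  show "Add C (h \<cdot> Zer C A B) (h \<cdot> Zer C A B) = h \<cdot> Zer C A B"
    using Comp_Add_right[OF z z h] Zer_idem[OF A homs_Obj(1)[OF h]] by simp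
qed

lemma Comp_Zer_left:
  assumes D: "D \<in> Obj C" and h: "h \<in> homs C A B"
  shows "Zer C B D \<cdot> h = Zer C A D"
proof (rule Zer_if_idem)
  note z = Zer_homs[OF homs_Obj(2)[OF h] D]
  show "Zer C B D \<cdot> h \<in> homs C A D"
    by (rule Comp_homs[OF h z])
  show "Add C (Zer C B D \<cdot> h) (Zer C B D \<cdot> h) = Zer C B D \<cdot> h"
    using Comp_Add_left[OF z z h] Zer_idem[OF homs_Obj(2)[OF h] D] by simp
qed

lemma neg_arr_homs: "f \<in> homs C A B \<Longrightarrow> neg_arr C f \<in> homs C A B"
  using group.inv_closed[of "hom_group C A B" f] hom_comm_group[of A B] homs_Obj[of f A B]
  by (auto simp: hom_group_def comm_group_def neg_arr_def homs_def)

lemma Add_neg_arr: "f \<in> homs C A B \<Longrightarrow> Add C f (neg_arr C f) = Zer C A B"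
  using group.r_inv[of "hom_group C A B" f] hom_comm_group[of A B] homs_Obj[of f A B]
  by (auto simp: hom_group_def comm_group_def neg_arr_def homs_def)

lemma neg_arr_unique:
  assumes "f \<in> homs C A B" "g \<in> homs C A B" "Add C f g = Zer C A B"
  shows "g = neg_arr C f"
proof -
  interpret comm_group "hom_group C A B"
    using hom_comm_group homs_Obj[OF assms(1)] by blast
  have "inv\<^bsub>hom_group C A B\<^esub> f = g"
    using assms m_comm[of f g] by (intro inv_equality) (simp_all add: hom_group_def)
  then show ?thesis
    using assms(1) by (simp add: neg_arr_def homs_def)
qed

lemma neg_arr_neg_arr:
  assumes f: "f \<in> homs C A B"
  shows "neg_arr C (neg_arr C f) = f"
proof -
  interpret comm_group "hom_group C A B"
    using hom_comm_group homs_Obj[OF f] by blast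
  show ?thesis
    using inv_inv[of f] neg_arr_homs[OF f] f
    by (simp add: hom_group_def neg_arr_def homs_def)
qed

lemma Comp_neg_arr_right:
  assumes f: "f \<in> homs C A B" and h: "h \<in> homs C B D"
  shows "h \<cdot> neg_arr C f = neg_arr C (h \<cdot> f)"
  using Comp_Add_right[OF f neg_arr_homs[OF f] h] Add_neg_arr[OF f]
    Comp_Zer_right[OF homs_Obj(1)[OF f] h]
  by (intro neg_arr_unique[OF Comp_homs[OF f h] Comp_homs[OF neg_arr_homs[OF f] h]]) simp

lemma Comp_neg_arr_left:
  assumes f: "f \<in> homs C B D" and h: "h \<in> homs C A B"
  shows "neg_arr C f \<cdot> h = neg_arr C (f \<cdot> h)"
  using Comp_Add_left[OF f neg_arr_homs[OF f] h] Add_neg_arr[OF f]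
    Comp_Zer_left[OF homs_Obj(2)[OF f] h]
  by (intro neg_arr_unique[OF Comp_homs[OF h f] Comp_homs[OF h neg_arr_homs[OF f]]]) simp

end

section \<open>Shifts, and exactness of representable functors\<close>

context triangulated_category
begin

lemma shO_Obj: "A \<in> Obj C \<Longrightarrow> shO C n A \<in> Obj C"
  using category_functor.fobj_Obj[OF shift_functor] by (simp add: shift_ftor_def)

lemma shA_homs: "f \<in> homs C A B \<Longrightarrow> shA C n f \<in> homs C (shO C n A) (shO C n B)"
  using category_functor.farr_homs[OF shift_functor] by (simp add: shift_ftor_def)

lemma shA_Comp:
  "\<lbrakk>f \<in> homs C A B; g \<in> homs C B D\<rbrakk> \<Longrightarrow> shA C n (g \<cdot> f) = shA C n g \<cdot> shA C n f"
  using category_functor.farr_Comp[OF shift_functor] by (simp add: shift_ftor_def)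

lemma shA_Idn: "A \<in> Obj C \<Longrightarrow> shA C n (Idn C A) = Idn C (shO C n A)"
  using category_functor.farr_Idn[OF shift_functor] by (simp add: shift_ftor_def)

lemma shA_Zer:
  assumes "A \<in> Obj C" "B \<in> Obj C"
  shows "shA C n (Zer C A B) = Zer C (shO C n A) (shO C n B)"
  using Zer_if_idem[OF shA_homs[OF Zer_homs[OF assms]]]
    shift_Add[OF Zer_homs[OF assms] Zer_homs[OF assms]] Zer_idem[OF assms] by simp

lemma shO_cancel: "A \<in> Obj C \<Longrightarrow> shO C (- n) (shO C n A) = A" "A \<in> Obj C \<Longrightarrow> shO C n (shO C (- n) A) = A"
  by (simp_all add: shO_add shO_0)

lemma shA_cancel: "f \<in> homs C A B \<Longrightarrow> shA C (- n) (shA C n f) = f"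
  "f \<in> homs C A B \<Longrightarrow> shA C n (shA C (- n) f) = f"
  by (simp_all add: shA_add shA_0 homs_def)

text \<open>TR3 fills in only the third arrow of a morphism of triangles. So the triangle on the
  identity of \<open>E\<close> and the given triangle are both rotated once, the pair of
  \<open>f\<close> and a zero map is completed by an arrow \<open>E[1] \<rightarrow> A[1]\<close>,
  and this arrow is shifted back.\<close>

lemma Tri_weak_kernel:
  assumes T: "(u, v, w) \<in> Tri C" and u: "u \<in> homs C A B" and v: "v \<in> homs C B D"
    and f: "f \<in> homs C E B" and vf: "v \<cdot> f = Zer C E D"
  obtains e where "e \<in> homs C E A" "u \<cdot> e = f"
proof -
  obtain V where V: "is_zero_object C V"
    using zero_object by blast
  have E: "E \<in> Obj C" and D: "D \<in> Obj C" and VO: "V \<in> Obj C"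
    using f v V homs_Obj by (auto simp: is_zero_object_def)
  define s where "s = shO C 1 E"
  have sE: "s \<in> Obj C"
    by (simp add: s_def shO_Obj E)
  have T0: "(Idn C E, Zer C E V, Zer C V s) \<in> Tri C"
    using TR1_id[OF E V] by (simp add: s_def)
  have w: "w \<in> homs C D (shO C 1 A)"
    using Tri_triangle[OF T] u v by (auto simp: is_triangle_def homs_def)
  \<comment> \<open>The sign that TR2 puts on the shifted identity of \<open>E\<close>. It cancels
    below against the sign on \<open>shA C 1 u\<close>.\<close>
  define n where "n = neg_arr C (Idn C s)"
  have "(Zer C E V, Zer C V s, n) \<in> Tri C"
    using T0 TR2[OF Tri_triangle[OF T0]] shA_Idn[OF E, of 1] by (simp add: n_def s_def)
  moreover have "(v, w, neg_arr C (shA C 1 u)) \<in> Tri C"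
    using T TR2[OF Tri_triangle[OF T]] by simp
  moreover note z = Zer_homs[OF E VO] Zer_homs[OF VO sE] Zer_homs[OF VO D]
  \<comment> \<open>The commuting square that TR3 asks for: both sides are zero, the right one by
    \<open>vf\<close>.\<close>
  moreover have "Zer C V D \<cdot> Zer C E V = v \<cdot> f"
    using Comp_Zer_right[OF E z(3)] vf by simp
  ultimately obtain e where
    e: "triangle_mor C (Zer C E V, Zer C V s, n) (v, w, neg_arr C (shA C 1 u)) f (Zer C V D) e"
    using TR3[of "Zer C E V" "Zer C V s" n v w "neg_arr C (shA C 1 u)" f "Zer C V D"] f v w
    by (auto simp: homs_def)
  have su: "shA C 1 u \<in> homs C (shO C 1 A) (shO C 1 B)" and sf: "shA C 1 f \<in> homs C s (shO C 1 B)"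
    using shA_homs[OF u] shA_homs[OF f] by (simp_all add: s_def)
  have n: "n \<in> homs C s s" "Dom C n = s"
    using neg_arr_homs[OF Idn_homs[OF sE]] by (auto simp: n_def homs_def)
  have eh: "e \<in> homs C s (shO C 1 A)"
    and eq: "shA C 1 f \<cdot> n = neg_arr C (shA C 1 u) \<cdot> e"
    using e n(2) neg_arr_homs[OF su] by (auto simp: triangle_mor_def homs_def)
  have "neg_arr C (shA C 1 f) = neg_arr C (shA C 1 u \<cdot> e)"
    using eq Comp_neg_arr_right[OF Idn_homs[OF sE] sf] Idn_right[OF sf] Comp_neg_arr_left[OF su eh]
    by (simp add: n_def)
  then have eq': "shA C 1 f = shA C 1 u \<cdot> e"
    using neg_arr_neg_arr[OF sf] neg_arr_neg_arr[OF Comp_homs[OF eh su]] by metis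
  show thesis
  proof
    show "shA C (- 1) e \<in> homs C E A"
      using shA_homs[OF eh, of "- 1"] shO_cancel(1)[OF E, of 1] shO_cancel(1)[OF homs_Obj(1)[OF u], of 1]
      by (simp add: s_def)
    show "u \<cdot> shA C (- 1) e = f"
      using shA_Comp[OF eh su, of "- 1"] shA_cancel(1)[OF u, of 1] shA_cancel(1)[OF f, of 1] eq' by simp
  qed
qed

text \<open>Shifting \<open>f\<close> by \<open>- n\<close>, rather than the triangle by
  \<open>n\<close>, stays with the given distinguished triangle and avoids the signs of its
  shifts.\<close>

lemma Tri_weak_kernel_shift:
  assumes T: "(u, v, w) \<in> Tri C" and u: "u \<in> homs C A B" and v: "v \<in> homs C B D"
    and f: "f \<in> homs C E (shO C n B)" and vf: "shA C n v \<cdot> f = Zer C E (shO C n D)"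
  obtains e where "e \<in> homs C E (shO C n A)" "shA C n u \<cdot> e = f"
proof -
  note Ob = homs_Obj(1)[OF f] homs_Obj[OF u] homs_Obj(2)[OF v]
  have f': "shA C (- n) f \<in> homs C (shO C (- n) E) B"
    using shA_homs[OF f, of "- n"] shO_cancel(1)[OF Ob(3)] by simp
  have "v \<cdot> shA C (- n) f = Zer C (shO C (- n) E) D"
    using shA_Comp[OF f shA_homs[OF v], of "- n"] shA_cancel(1)[OF v] vf
      shA_Zer[OF Ob(1) shO_Obj[OF Ob(4)], of "- n" n] shO_cancel(1)[OF Ob(4)] by simp
  then obtain e where e: "e \<in> homs C (shO C (- n) E) A" "u \<cdot> e = shA C (- n) f"
    using Tri_weak_kernel[OF T u v f'] by blast
  show thesis
  proof
    show "shA C n e \<in> homs C E (shO C n A)"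
      using shA_homs[OF e(1), of n] shO_cancel(2)[OF Ob(1)] by simp
    show "shA C n u \<cdot> shA C n e = f"
      using shA_Comp[OF e(1) u, of n] e(2) shA_cancel(2)[OF f, of n] by simp
  qed
qed

end

section \<open>Exact functors, shifts and zero maps\<close>

context exact_functor
begin

lemma fsh_homs:
  "A \<in> Obj C \<Longrightarrow> fsh F n A \<in> homs D (fobj F (shO C n A)) (shO D n (fobj F A))"
  using fsh_nat by (simp add: nat_iso_def nat_trans_def comp_ftor_def shift_ftor_def)

lemma fsh_iso: "A \<in> Obj C \<Longrightarrow> iso_arr D (fsh F n A)"
  using fsh_nat by (simp add: nat_iso_def)

lemma fsh_square:
  "f \<in> homs C A B \<Longrightarrow> fsh F n B \<cdot>\<^bsub>D\<^esub> farr F (shA C n f) = shA D n (farr F f) \<cdot>\<^bsub>D\<^esub> fsh F n A"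
  using nat_trans_square[of _ _ _ _ "fsh F n"] fsh_nat
  by (fastforce simp: nat_iso_def comp_ftor_def shift_ftor_def)

lemma farr_Zer:
  assumes "A \<in> Obj C" "B \<in> Obj C"
  shows "farr F (Zer C A B) = Zer D (fobj F A) (fobj F B)"
  using D.Zer_if_idem[OF farr_homs[OF C.Zer_homs[OF assms]]]
    farr_Add[OF C.Zer_homs[OF assms] C.Zer_homs[OF assms]] C.Zer_idem[OF assms] by simp

end

section \<open>Fibres of group homomorphisms as torsors\<close>

text \<open>The fibre over \<open>c\<close> is a coset of the kernel, so its image under
  \<open>\<psi>\<close> is a coset of the image of the kernel. Transitivity comes from division in
  \<open>G\<close>, freeness from cancellation in \<open>K\<close>. It is applied with
  \<open>forg\<close> as \<open>\<phi>\<close> and the adjunction map \<open>supp_adj\<close> as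
  \<open>\<psi>\<close>.\<close>

lemma torsor_fibre:
  fixes G :: "('a, 'u) monoid_scheme" and H :: "('b, 'v) monoid_scheme" and K :: "'c monoid"
  assumes "group_hom G H \<phi>" "group_hom G K \<psi>"
    and E: "E = \<psi> ` {t \<in> carrier G. \<phi> t = c}" and ne: "{t \<in> carrier G. \<phi> t = c} \<noteq> {}"
    and N: "N = K\<lparr>carrier := \<psi> ` kernel G H \<phi>\<rparr>"
  shows "torsor N E (\<lambda>k. \<lambda>s\<in>E. k \<otimes>\<^bsub>N\<^esub> s)"
proof -
  interpret p: group_hom G H \<phi> by fact
  interpret q: group_hom G K \<psi> by fact
  have sub: "subgroup (\<psi> ` kernel G H \<phi>) K"
    using q.subgroup_img_is_subgroup p.subgroup_kernel by blast
  then have "group N"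
    using N q.H.subgroup_imp_group by blast
  then interpret N: group N .
  have car: "carrier N = \<psi> ` kernel G H \<phi>" and mul: "mult N = mult K" and on: "one N = one K"
    by (simp_all add: N)
  have NK: "k \<in> carrier K" if "k \<in> carrier N" for k
    using that subgroup.subset[OF sub] by (auto simp: car)
  have EK: "s \<in> carrier K" if "s \<in> E" for s
    using that by (auto simp: E)
  have act: "k \<otimes>\<^bsub>N\<^esub> s \<in> E" if k: "k \<in> carrier N" and s: "s \<in> E" for k s
  proof -
    obtain a b where "a \<in> kernel G H \<phi>" "k = \<psi> a" "b \<in> carrier G" "\<phi> b = c" "s = \<psi> b"
      using k s by (auto simp: car E)
    then show ?thesis
      by (auto simp: E mul kernel_def intro!: image_eqI[of _ _ "a \<otimes>\<^bsub>G\<^esub> b"])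
  qed
  have trans: "\<exists>k\<in>carrier N. k \<otimes>\<^bsub>N\<^esub> x = y" if x: "x \<in> E" and y: "y \<in> E" for x y
  proof -
    obtain a b where ab: "a \<in> carrier G" "\<phi> a = c" "x = \<psi> a" "b \<in> carrier G" "\<phi> b = c" "y = \<psi> b"
      using x y by (auto simp: E)
    then have "b \<otimes>\<^bsub>G\<^esub> inv\<^bsub>G\<^esub> a \<in> kernel G H \<phi>"
      using p.hom_closed[of a] by (auto simp: kernel_def)
    moreover have "\<psi> (b \<otimes>\<^bsub>G\<^esub> inv\<^bsub>G\<^esub> a) \<otimes>\<^bsub>N\<^esub> x = y"
      using ab by (simp add: mul q.H.m_assoc)
    ultimately show ?thesis
      by (auto simp: car)
  qed
  have unq: "k = k'" if "k \<in> carrier N" "k' \<in> carrier N" "x \<in> E" "k \<otimes>\<^bsub>N\<^esub> x = k' \<otimes>\<^bsub>N\<^esub> x" for k k' x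
    using that NK EK by (simp add: mul)
  let ?f = "\<lambda>k. \<lambda>s\<in>E. k \<otimes>\<^bsub>N\<^esub> s"
  \<comment> \<open>A \<open>group_action\<close> is a homomorphism into \<open>BijGroup E\<close>,
    whose elements are extensional bijections of \<open>E\<close>; this is why the translations are
    restricted to \<open>E\<close>.\<close>
  have bij: "?f k \<in> Bij E" if k: "k \<in> carrier N" for k
  proof -
    have "y \<in> (\<lambda>s. k \<otimes>\<^bsub>N\<^esub> s) ` E" if "y \<in> E" for y
      using that act[OF N.inv_closed[OF k]] NK[OF k] NK[OF N.inv_closed[OF k]] EK k N.r_inv[OF k]
      by (intro image_eqI[of _ _ "inv\<^bsub>N\<^esub> k \<otimes>\<^bsub>N\<^esub> y"]) (auto simp: mul on q.H.m_assoc[symmetric])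
    then have "bij_betw (\<lambda>s. k \<otimes>\<^bsub>N\<^esub> s) E E"
      using NK[OF k] EK act[OF k] by (auto simp: bij_betw_def inj_on_def mul)
    then show ?thesis
      by (simp add: Bij_def bij_betw_restrict_eq)
  qed
  have "?f (k \<otimes>\<^bsub>N\<^esub> l) = ?f k \<otimes>\<^bsub>BijGroup E\<^esub> ?f l" if "k \<in> carrier N" "l \<in> carrier N" for k l
    using that bij act NK EK
    by (auto simp: BijGroup_def compose_def restrict_def fun_eq_iff mul q.H.m_assoc)
  then have "?f \<in> hom N (BijGroup E)"
    using bij by (auto simp: hom_def BijGroup_def)
  then have "group_action N E ?f"
    unfolding group_action_def group_hom_def group_hom_axioms_def
    using \<open>group N\<close> group_BijGroup by blast
  moreover have "E \<noteq> {}"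
    using ne by (auto simp: E)
  moreover have "\<exists>!k. k \<in> carrier N \<and> ?f k x = y" if "x \<in> E" "y \<in> E" for x y
    using trans[OF that] unq[of _ _ x] that by auto
  ultimately show ?thesis
    by (auto simp: torsor_def)
qed

lemma (in additive_category) group_hom_Comp:
  assumes A: "A \<in> Obj C" and h: "h \<in> homs C B D"
  shows "group_hom (hom_group C A B) (hom_group C A D) (\<lambda>f. h \<cdot> f)"
proof -
  have "(\<lambda>f. h \<cdot> f) \<in> hom (hom_group C A B) (hom_group C A D)"
    using Comp_homs[OF _ h] Comp_Add_right[OF _ _ h] by (auto simp: hom_def hom_group_def)
  then show ?thesis
    using hom_comm_group[OF A homs_Obj(1)[OF h]] hom_comm_group[OF A homs_Obj(2)[OF h]]
    by (simp add: group_hom_def group_hom_axioms_def comm_group_def)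
qed

lemma group_hom_compose:
  assumes "group_hom G H \<phi>" "group_hom H K \<psi>"
  shows "group_hom G K (\<lambda>x. \<psi> (\<phi> x))"
  using assms Group.hom_compose[of \<phi> G H \<psi> K]
  by (simp add: group_hom_def group_hom_axioms_def comp_def)

section \<open>Pullback of cohomology classes\<close>

lemma carrier_cohom: "carrier (cohom S X d A) = homs (coef S X) (unitO (coef S X)) (shO (coef S X) d A)"
  and mult_cohom: "mult (cohom S X d A) = Add (coef S X)"
  and one_cohom: "one (cohom S X d A) = Zer (coef S X) (unitO (coef S X)) (shO (coef S X) d A)"
  by (simp_all add: cohom_def hom_group_def)

context coefficient_system
begin

lemma shA_group_hom:
  assumes X: "X \<in> Obj (spc S)" and h: "h \<in> homs (coef S X) M N"
  shows "group_hom (cohom S X d M) (cohom S X d N) (\<lambda>t. shA (coef S X) d h \<cdot>\<^bsub>coef S X\<^esub> t)"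
proof -
  interpret sym_monoidal_triangulated "coef S X"
    using X by (rule coef_category)
  show ?thesis
    unfolding cohom_def by (rule group_hom_Comp[OF unitO_Obj shA_homs[OF h]])
qed

context
  fixes f X Y
  assumes f: "f \<in> homs (spc S) X Y"
begin

interpretation F: sym_monoidal_exact_functor "coef S Y" "coef S X" "pull S f"
  using f by (rule pull_functor)

lemma pull_class_eq:
  "pull_class S f d M t = fsh (pull S f) d M \<cdot>\<^bsub>coef S X\<^esub> farr (pull S f) t \<cdot>\<^bsub>coef S X\<^esub> fun1 (pull S f)"
  using f by (simp add: pull_class_def homs_def Let_def)

lemma pull_class_homs:
  assumes "M \<in> Obj (coef S Y)" "t \<in> carrier (cohom S Y d M)"
  shows "pull_class S f d M t \<in> carrier (cohom S X d (fobj (pull S f) M))"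
  using assms unfolding pull_class_eq carrier_cohom
  by (intro F.D.Comp_homs[OF F.D.Comp_homs[OF F.fun1_homs F.farr_homs] F.fsh_homs])

lemma pull_class_group_hom:
  assumes M: "M \<in> Obj (coef S Y)"
  shows "group_hom (cohom S Y d M) (cohom S X d (fobj (pull S f) M)) (pull_class S f d M)"
proof -
  have add: "pull_class S f d M (Add (coef S Y) s t) = Add (coef S X) (pull_class S f d M s) (pull_class S f d M t)"
    if s: "s \<in> carrier (cohom S Y d M)" and t: "t \<in> carrier (cohom S Y d M)" for s t
  proof -
    note Fs = F.farr_homs[OF s[unfolded carrier_cohom]] and Ft = F.farr_homs[OF t[unfolded carrier_cohom]]
    show ?thesis
      unfolding pull_class_eq
      by (simp add: F.farr_Add[OF s[unfolded carrier_cohom] t[unfolded carrier_cohom]]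
          F.D.Comp_Add_left[OF Fs Ft F.fun1_homs]
          F.D.Comp_Add_right[OF F.D.Comp_homs[OF F.fun1_homs Fs] F.D.Comp_homs[OF F.fun1_homs Ft] F.fsh_homs[OF M]])
  qed
  have "group (cohom S Y d M)" "group (cohom S X d (fobj (pull S f) M))"
    using F.C.hom_comm_group[OF F.C.unitO_Obj F.C.shO_Obj[OF M, of d]]
      F.D.hom_comm_group[OF F.D.unitO_Obj F.D.shO_Obj[OF F.fobj_Obj[OF M], of d]]
    by (simp_all add: cohom_def comm_group_def)
  then show ?thesis
    using add pull_class_homs[OF M]
    by (auto simp: group_hom_def group_hom_axioms_def hom_def mult_cohom)
qed

text \<open>Naturality of \<open>fsh\<close>, applied to \<open>h\<close>. It carries the counits
  and the transformation \<open>supp_exch\<close> through the pullback of classes.\<close>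

lemma pull_class_shA:
  assumes h: "h \<in> homs (coef S Y) M N" and t: "t \<in> carrier (cohom S Y d M)"
  shows "pull_class S f d N (shA (coef S Y) d h \<cdot>\<^bsub>coef S Y\<^esub> t) =
    shA (coef S X) d (farr (pull S f) h) \<cdot>\<^bsub>coef S X\<^esub> pull_class S f d M t"
proof -
  note t = t[unfolded carrier_cohom] and sh = F.C.shA_homs[OF h, of d]
  note Ft = F.farr_homs[OF t] and Fsh = F.farr_homs[OF sh] and M = F.C.homs_Obj(1)[OF h]
    and N = F.C.homs_Obj(2)[OF h]
  note Ft1 = F.D.Comp_homs[OF F.fun1_homs Ft]
  have "pull_class S f d N (shA (coef S Y) d h \<cdot>\<^bsub>coef S Y\<^esub> t) =
      (fsh (pull S f) d N \<cdot>\<^bsub>coef S X\<^esub> farr (pull S f) (shA (coef S Y) d h)) \<cdot>\<^bsub>coef S X\<^esub>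
      farr (pull S f) t \<cdot>\<^bsub>coef S X\<^esub> fun1 (pull S f)"
    unfolding pull_class_eq
    by (simp add: F.farr_Comp[OF t sh] F.D.Comp_assoc[OF F.fun1_homs Ft Fsh]
        F.D.Comp_assoc[OF Ft1 Fsh F.fsh_homs[OF N]])
  then show ?thesis
    unfolding pull_class_eq
    by (simp add: F.fsh_square[OF h] F.D.Comp_assoc[OF Ft1 F.fsh_homs[OF M] F.D.shA_homs[OF F.farr_homs[OF h]]])
qed

text \<open>\<open>pull_class\<close> only surrounds \<open>farr (pull S f) t\<close> by the
  isomorphisms \<open>fsh\<close> and \<open>fun1\<close>, which can be cancelled on either
  side.\<close>

lemma farr_eq_Zer_if_pull_class_eq_one:
  assumes M: "M \<in> Obj (coef S Y)" and t: "t \<in> carrier (cohom S Y d M)"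
    and "pull_class S f d M t = \<one>\<^bsub>cohom S X d (fobj (pull S f) M)\<^esub>"
  shows "farr (pull S f) t =
    Zer (coef S X) (fobj (pull S f) (unitO (coef S Y))) (fobj (pull S f) (shO (coef S Y) d M))"
proof -
  note Ft = F.farr_homs[OF t[unfolded carrier_cohom]]
  note Ob = F.D.homs_Obj[OF Ft]
  note z = F.D.Zer_homs[OF F.D.unitO_Obj Ob(2)]
  have "farr (pull S f) t \<cdot>\<^bsub>coef S X\<^esub> fun1 (pull S f) =
      Zer (coef S X) (unitO (coef S X)) (fobj (pull S f) (shO (coef S Y) d M))"
    using assms(3) F.D.Comp_Zer_right[OF F.D.unitO_Obj F.fsh_homs[OF M]]
    by (intro F.D.iso_cancel_left[OF F.fsh_iso[OF M] F.fsh_homs[OF M] F.D.Comp_homs[OF F.fun1_homs Ft] z])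
      (simp add: pull_class_eq one_cohom)
  then show ?thesis
    using F.D.Comp_Zer_left[OF Ob(2) F.fun1_homs]
    by (intro F.D.iso_cancel_right[OF F.fun1_iso F.fun1_homs Ft F.D.Zer_homs[OF Ob]]) simp
qed

text \<open>The unit \<open>M \<rightarrow> f\<^sub>* f\<^sup>* M\<close> is not assumed to commute with shifts. Transposing along
  \<open>f\<^sub>*((f\<^sup>* M)[d]) \<cong> (f\<^sub>* f\<^sup>* M)[d]\<close> instead, vanishing only needs \<open>f\<^sup>*\<close> of the map to vanish.\<close>

lemma unt_comp_eq_one_if_pull_class_eq_one:
  assumes M: "M \<in> Obj (coef S Y)" and t: "t \<in> carrier (cohom S Y d M)"
    and "pull_class S f d M t = \<one>\<^bsub>cohom S X d (fobj (pull S f) M)\<^esub>"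
  shows "shA (coef S Y) d (unt S f M) \<cdot>\<^bsub>coef S Y\<^esub> t =
    \<one>\<^bsub>cohom S Y d (fobj (push S f) (fobj (pull S f) M))\<^esub>"
proof -
  interpret P: exact_functor "coef S X" "coef S Y" "push S f"
    using f by (rule push_functor)
  interpret a: adjunction "coef S Y" "coef S X" "pull S f" "push S f" "unt S f" "cnt S f"
    using f by (rule pull_push_adj)
  note t' = t[unfolded carrier_cohom]
  define B where "B = fobj (pull S f) M"
  define u where "u = shA (coef S Y) d (unt S f M)"
  define q where "q = fsh (push S f) d B"
  define k where "k = inv_arr (coef S Y) q"
  have B: "B \<in> Obj (coef S X)"
    by (simp add: B_def F.fobj_Obj M)
  note Bd = F.D.shO_Obj[OF B, of d]
  have u: "u \<in> homs (coef S Y) (shO (coef S Y) d M) (shO (coef S Y) d (fobj (push S f) B))"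
    by (simp add: u_def B_def F.C.shA_homs a.unit_homs M)
  have q: "q \<in> homs (coef S Y) (fobj (push S f) (shO (coef S X) d B)) (shO (coef S Y) d (fobj (push S f) B))"
    by (simp add: q_def P.fsh_homs B)
  note k = F.C.inv_arr_iso[OF P.fsh_iso[OF B, of d, folded q_def] q, folded k_def]
  note ku = F.C.Comp_homs[OF u k(1)]
  note kut = F.C.Comp_homs[OF t' ku]
  note Ob1 = F.fobj_Obj[OF F.C.unitO_Obj]
  have "farr (pull S f) ((k \<cdot>\<^bsub>coef S Y\<^esub> u) \<cdot>\<^bsub>coef S Y\<^esub> t) =
      Zer (coef S X) (fobj (pull S f) (unitO (coef S Y))) (fobj (pull S f) (fobj (push S f) (shO (coef S X) d B)))"
    by (simp add: F.farr_Comp[OF t' ku] farr_eq_Zer_if_pull_class_eq_one[OF assms]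
        F.D.Comp_Zer_right[OF Ob1 F.farr_homs[OF ku]])
  \<comment> \<open>\<open>transpose_counit\<close> rebuilds the composite from its image under
    \<open>pull S f\<close>, which has just been shown to be zero.\<close>
  then have "(k \<cdot>\<^bsub>coef S Y\<^esub> u) \<cdot>\<^bsub>coef S Y\<^esub> t =
      Zer (coef S Y) (unitO (coef S Y)) (fobj (push S f) (shO (coef S X) d B))"
    using a.transpose_counit[OF Bd kut] P.farr_Zer[OF Ob1 F.fobj_Obj[OF P.fobj_Obj[OF Bd]]]
      F.C.Comp_Zer_left[OF P.fobj_Obj[OF F.fobj_Obj[OF P.fobj_Obj[OF Bd]]] a.unit_homs[OF F.C.unitO_Obj]]
      F.C.Comp_Zer_right[OF F.C.unitO_Obj P.farr_homs[OF a.counit_homs[OF Bd]]]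
    by simp
  moreover have "q \<cdot>\<^bsub>coef S Y\<^esub> (k \<cdot>\<^bsub>coef S Y\<^esub> u) \<cdot>\<^bsub>coef S Y\<^esub> t = u \<cdot>\<^bsub>coef S Y\<^esub> t"
    using F.C.Comp_assoc[OF t' u k(1)] F.C.Comp_assoc[OF F.C.Comp_homs[OF t' u] k(1) q] k(3)
      F.C.Idn_left[OF F.C.Comp_homs[OF t' u]] by simp
  ultimately show ?thesis
    using F.C.Comp_Zer_right[OF F.C.unitO_Obj q] by (simp add: one_cohom u_def B_def)
qed

end

text \<open>The comparison \<open>pcomp\<close> is moved through the composite from right to left:
  being monoidal it matches the units \<open>fun1\<close>, being natural it passes \<open>t\<close>,
  and being exact it matches the shift isomorphisms \<open>fsh\<close>.\<close>

lemma pull_class_pull_class: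
  assumes f: "f \<in> homs (spc S) X Y" and g: "g \<in> homs (spc S) Y W"
    and M: "M \<in> Obj (coef S W)" and t: "t \<in> carrier (cohom S W d M)"
  shows "pull_class S f d (fobj (pull S g) M) (pull_class S g d M t) =
    shA (coef S X) d (pcomp S g f M) \<cdot>\<^bsub>coef S X\<^esub> pull_class S (g \<cdot>\<^bsub>spc S\<^esub> f) d M t"
proof -
  interpret spaces "spc S" by (rule spaces)
  note gf = Comp_homs[OF f g]
  interpret F: sym_monoidal_exact_functor "coef S Y" "coef S X" "pull S f"
    using f by (rule pull_functor)
  interpret G: sym_monoidal_exact_functor "coef S W" "coef S Y" "pull S g"
    using g by (rule pull_functor)
  interpret H: sym_monoidal_exact_functor "coef S W" "coef S X" "pull S (g \<cdot>\<^bsub>spc S\<^esub> f)"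
    using gf by (rule pull_functor)
  note t' = t[unfolded carrier_cohom]
  define p where "p = pcomp S g f"
  have p: "p N \<in> homs (coef S X) (fobj (pull S (g \<cdot>\<^bsub>spc S\<^esub> f)) N) (fobj (pull S f) (fobj (pull S g) N))"
    if "N \<in> Obj (coef S W)" for N
    using pcomp_iso[OF f g] that by (simp add: nat_iso_def nat_trans_def comp_sme_def p_def)
  have p_nat: "p (shO (coef S W) d M) \<cdot>\<^bsub>coef S X\<^esub> farr (pull S (g \<cdot>\<^bsub>spc S\<^esub> f)) t =
      farr (pull S f) (farr (pull S g) t) \<cdot>\<^bsub>coef S X\<^esub> p (unitO (coef S W))"
    using nat_trans_square[OF _ t', of "coef S X" _ _ p] pcomp_iso[OF f g]
    by (fastforce simp: nat_iso_def comp_sme_def p_def)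
  have p_sh: "(fsh (pull S f) d (fobj (pull S g) M) \<cdot>\<^bsub>coef S X\<^esub> farr (pull S f) (fsh (pull S g) d M))
      \<cdot>\<^bsub>coef S X\<^esub> p (shO (coef S W) d M) =
      shA (coef S X) d (p M) \<cdot>\<^bsub>coef S X\<^esub> fsh (pull S (g \<cdot>\<^bsub>spc S\<^esub> f)) d M"
    using pcomp_exact[OF f g] M by (simp add: exact_trans_def comp_sme_def p_def)
  have p_one: "p (unitO (coef S W)) \<cdot>\<^bsub>coef S X\<^esub> fun1 (pull S (g \<cdot>\<^bsub>spc S\<^esub> f)) =
      farr (pull S f) (fun1 (pull S g)) \<cdot>\<^bsub>coef S X\<^esub> fun1 (pull S f)"
    using pcomp_monoidal[OF f g] by (simp add: monoidal_trans_def comp_sme_def p_def)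
  note Wd = G.C.shO_Obj[OF M, of d]
  note Gt = G.farr_homs[OF t'] and Ht = H.farr_homs[OF t']
  note Gt1 = F.C.Comp_homs[OF G.fun1_homs Gt]
  note Fsh = F.fsh_homs[OF G.fobj_Obj[OF M], of d] and FGsh = F.farr_homs[OF G.fsh_homs[OF M, of d]]
  note FGt = F.farr_homs[OF Gt] and FG1 = F.farr_homs[OF G.fun1_homs]
  note Ht1 = F.D.Comp_homs[OF H.fun1_homs Ht] and FGF1 = F.D.Comp_homs[OF F.fun1_homs FG1]
  note shs = F.D.Comp_homs[OF FGsh Fsh]
  have "pull_class S f d (fobj (pull S g) M) (pull_class S g d M t) =
      fsh (pull S f) d (fobj (pull S g) M) \<cdot>\<^bsub>coef S X\<^esub> farr (pull S f) (fsh (pull S g) d M) \<cdot>\<^bsub>coef S X\<^esub>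
      farr (pull S f) (farr (pull S g) t) \<cdot>\<^bsub>coef S X\<^esub> farr (pull S f) (fun1 (pull S g)) \<cdot>\<^bsub>coef S X\<^esub> fun1 (pull S f)"
    unfolding pull_class_eq[OF f] pull_class_eq[OF g]
    by (simp add: F.farr_Comp[OF Gt1 G.fsh_homs[OF M]] F.farr_Comp[OF G.fun1_homs Gt]
        F.D.Comp_assoc[OF F.fun1_homs F.D.Comp_homs[OF FG1 FGt] FGsh] F.D.Comp_assoc[OF F.fun1_homs FG1 FGt])
  also have "\<dots> = (fsh (pull S f) d (fobj (pull S g) M) \<cdot>\<^bsub>coef S X\<^esub> farr (pull S f) (fsh (pull S g) d M)) \<cdot>\<^bsub>coef S X\<^esub>
      (farr (pull S f) (farr (pull S g) t) \<cdot>\<^bsub>coef S X\<^esub> p (unitO (coef S W))) \<cdot>\<^bsub>coef S X\<^esub> fun1 (pull S (g \<cdot>\<^bsub>spc S\<^esub> f))"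
    by (simp add: F.D.Comp_assoc[OF H.fun1_homs p[OF G.C.unitO_Obj] FGt] p_one
        F.D.Comp_assoc[OF F.D.Comp_homs[OF FGF1 FGt] FGsh Fsh])
  also have "\<dots> = ((fsh (pull S f) d (fobj (pull S g) M) \<cdot>\<^bsub>coef S X\<^esub> farr (pull S f) (fsh (pull S g) d M)) \<cdot>\<^bsub>coef S X\<^esub>
      p (shO (coef S W) d M)) \<cdot>\<^bsub>coef S X\<^esub> farr (pull S (g \<cdot>\<^bsub>spc S\<^esub> f)) t \<cdot>\<^bsub>coef S X\<^esub> fun1 (pull S (g \<cdot>\<^bsub>spc S\<^esub> f))"
    by (simp add: p_nat[symmetric] F.D.Comp_assoc[OF H.fun1_homs Ht p[OF Wd]] F.D.Comp_assoc[OF Ht1 p[OF Wd] shs])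
  finally show ?thesis
    unfolding pull_class_eq[OF gf] p_sh p_def[symmetric]
    by (simp add: F.D.Comp_assoc[OF Ht1 H.fsh_homs[OF M] F.D.shA_homs[OF p[OF M]]])
qed

end

section \<open>Localization torsors\<close>

text \<open>One closed-open pair with its endpoints named, in place of \<open>Dom\<close> and
  \<open>Cod\<close> of the immersions. Base change instantiates it twice, over \<open>X\<close> and
  over \<open>X'\<close>.\<close>

locale localization = coefficient_system S
  for S :: "('s, 'f, 'o, 'm) coeff" +
  fixes X Z U :: 's and i j :: 'f and R :: "('o, 'm) recoll"
  assumes i: "i \<in> homs (spc S) Z X" and j: "j \<in> homs (spc S) U X"
    and recollement: "recollement S i j R"
begin

lemma ishriek_adjunction: "adjunction (coef S Z) (coef S X) (push S i) (ishriek R) (iunit R) (icounit R)"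
  using recollement i by (simp add: recollement_def homs_def)

lemma localization_triangle:
  "M \<in> Obj (coef S X) \<Longrightarrow> (icounit R M, unt S j M, conn2 R M) \<in> Tri (coef S X)"
  using recollement i by (simp add: recollement_def homs_def)

sublocale spaces "spc S"
  by (rule spaces)

sublocale pull_i: sym_monoidal_exact_functor "coef S X" "coef S Z" "pull S i"
  by (rule pull_functor[OF i])

sublocale push_i: exact_functor "coef S Z" "coef S X" "push S i"
  by (rule push_functor[OF i])

sublocale pull_push: adjunction "coef S X" "coef S Z" "pull S i" "push S i" "unt S i" "cnt S i"
  by (rule pull_push_adj[OF i])

sublocale push_shriek: adjunction "coef S Z" "coef S X" "push S i" "ishriek R" "iunit R" "icounit R"
  by (rule ishriek_adjunction)

lemma forg_eq: "forg S R i d A t = shA (coef S X) d (icounit R A) \<cdot>\<^bsub>coef S X\<^esub> t"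
  using i by (simp add: forg_def homs_def Let_def)

lemma cohom_supp_eq: "cohom_supp S R i d A = cohom S X d (fobj (push S i) (fobj (ishriek R) A))"
  using i by (simp add: cohom_supp_def homs_def)

lemma supp_adj_eq: "supp_adj S R i d A t = shA (coef S Z) d (cnt S i (fobj (ishriek R) A)) \<cdot>\<^bsub>coef S Z\<^esub>
    pull_class S i d (fobj (push S i) (fobj (ishriek R) A)) t"
  using i by (simp add: supp_adj_def homs_def Let_def)

context
  fixes A
  assumes A: "A \<in> Obj (coef S X)"
begin

lemma forg_group_hom: "group_hom (cohom_supp S R i d A) (cohom S X d A) (forg S R i d A)"
  unfolding cohom_supp_eq forg_eq[abs_def]
  by (rule shA_group_hom[OF homs_Obj(2)[OF i] push_shriek.counit_homs[OF A]])

lemma supp_adj_group_hom: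
  "group_hom (cohom_supp S R i d A) (cohom S Z d (fobj (ishriek R) A)) (supp_adj S R i d A)"
  unfolding cohom_supp_eq supp_adj_eq[abs_def]
  by (rule group_hom_compose[OF pull_class_group_hom[OF i] shA_group_hom[OF homs_Obj(1)[OF i]]])
    (simp_all add: push_i.fobj_Obj push_shriek.G.fobj_Obj pull_push.counit_homs A)

text \<open>Since \<open>j\<^sup>* c\<close> vanishes, \<open>c\<close> dies in
  \<open>j\<^sub>* j\<^sup>* A\<close>; exactness at the middle term of \<open>i\<^sub>* i\<^sup>! A
  \<rightarrow> A \<rightarrow> j\<^sub>* j\<^sup>* A\<close> then gives a lift.\<close>

lemma Lift_nonempty:
  assumes c: "c \<in> carrier (cohom S X d A)"
    and "pull_class S j d A c = \<one>\<^bsub>cohom S U d (fobj (pull S j) A)\<^esub>"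
  shows "Lift S R i d A c \<noteq> {}"
proof -
  interpret adjunction "coef S X" "coef S U" "pull S j" "push S j" "unt S j" "cnt S j"
    by (rule pull_push_adj[OF j])
  obtain e where "e \<in> homs (coef S X) (unitO (coef S X))
        (shO (coef S X) d (fobj (push S i) (fobj (ishriek R) A)))"
      "shA (coef S X) d (icounit R A) \<cdot>\<^bsub>coef S X\<^esub> e = c"
    using pull_i.C.Tri_weak_kernel_shift[OF localization_triangle[OF A]
        push_shriek.counit_homs[OF A] unit_homs[OF A]]
      c unt_comp_eq_one_if_pull_class_eq_one[OF j A assms] unfolding carrier_cohom one_cohom by blast
  then show ?thesis
    by (auto simp: Lift_def cohom_supp_eq carrier_cohom forg_eq)
qed

lemma Loc_tor_subset: "Loc_tor S R i d A c \<subseteq> carrier (cohom S Z d (fobj (ishriek R) A))"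
  using group_hom.hom_closed[OF supp_adj_group_hom] by (auto simp: Loc_tor_def Lift_def)

lemma Loc_torsor:
  assumes "c \<in> carrier (cohom S X d A)"
    and "pull_class S j d A c = \<one>\<^bsub>cohom S U d (fobj (pull S j) A)\<^esub>"
  shows "torsor (Loc_group S R i d A) (Loc_tor S R i d A c) (Loc_act S R i d A c)"
  unfolding Loc_act_def
proof (rule torsor_fibre[OF forg_group_hom supp_adj_group_hom])
  show "Loc_tor S R i d A c = supp_adj S R i d A ` {t \<in> carrier (cohom_supp S R i d A). forg S R i d A t = c}"
    by (simp add: Loc_tor_def Lift_def)
  show "{t \<in> carrier (cohom_supp S R i d A). forg S R i d A t = c} \<noteq> {}"
    using Lift_nonempty[OF assms] by (simp add: Lift_def)
  show "Loc_group S R i d A = cohom S Z d (fobj (ishriek R) A)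
      \<lparr>carrier := supp_adj S R i d A ` kernel (cohom_supp S R i d A) (cohom S X d A) (forg S R i d A)\<rparr>"
    using i by (simp add: Loc_group_def homs_def)
qed

text \<open>The kernel of \<open>forg\<close> consists of the lifts of the zero class. Whatever is
  proved about \<open>Loc_tor\<close> for an arbitrary class thus applies to the acting group as
  well.\<close>

lemma carrier_Loc_group: "carrier (Loc_group S R i d A) = Loc_tor S R i d A \<one>\<^bsub>cohom S X d A\<^esub>"
  using i by (simp add: Loc_group_def Loc_tor_def Lift_def kernel_def homs_def)

lemma mult_Loc_group: "mult (Loc_group S R i d A) = mult (cohom S Z d (fobj (ishriek R) A))"
  using i by (simp add: Loc_group_def homs_def)

end

end

section \<open>Pullback of classes around a commutative square\<close>

context coefficient_system
begin

context
  fixes f h' h f' and V B P W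
  assumes f: "f \<in> homs (spc S) V B" and h': "h' \<in> homs (spc S) P V"
    and h: "h \<in> homs (spc S) W B" and f': "f' \<in> homs (spc S) P W"
    and comm: "f \<cdot>\<^bsub>spc S\<^esub> h' = h \<cdot>\<^bsub>spc S\<^esub> f'"
begin

interpretation spaces "spc S"
  by (rule spaces)

interpretation P: sym_monoidal_triangulated "coef S P"
  by (rule coef_category[OF homs_Obj(1)[OF f']])

lemma square_iso_eq:
  "square_iso S f h' h f' M = pcomp S f h' M \<cdot>\<^bsub>coef S P\<^esub> inv_arr (coef S P) (pcomp S h f' M)"
  using f' by (simp add: square_iso_def homs_def Let_def)

lemma pcomp_props:
  assumes M: "M \<in> Obj (coef S B)"
  shows "pcomp S f h' M \<in> homs (coef S P) (fobj (pull S (h \<cdot>\<^bsub>spc S\<^esub> f')) M) (fobj (pull S h') (fobj (pull S f) M))"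
    "pcomp S h f' M \<in> homs (coef S P) (fobj (pull S (h \<cdot>\<^bsub>spc S\<^esub> f')) M) (fobj (pull S f') (fobj (pull S h) M))"
    "iso_arr (coef S P) (pcomp S h f' M)"
  using pcomp_iso[OF h' f] pcomp_iso[OF f' h] M comm
  by (simp_all add: nat_iso_def nat_trans_def comp_sme_def)

lemma square_iso_homs:
  assumes M: "M \<in> Obj (coef S B)"
  shows "square_iso S f h' h f' M \<in>
    homs (coef S P) (fobj (pull S f') (fobj (pull S h) M)) (fobj (pull S h') (fobj (pull S f) M))"
  unfolding square_iso_eq
  by (rule P.Comp_homs[OF P.inv_arr_iso(1)[OF pcomp_props(3,2)[OF M]] pcomp_props(1)[OF M]])

text \<open>Both iterated pullbacks are compared through \<open>pcomp\<close> with the pullback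
  along the common composite, and \<open>square_iso\<close> is the quotient of the two
  comparisons.\<close>

lemma pull_class_square:
  assumes M: "M \<in> Obj (coef S B)" and t: "t \<in> carrier (cohom S B d M)"
  shows "pull_class S h' d (fobj (pull S f) M) (pull_class S f d M t) =
    shA (coef S P) d (square_iso S f h' h f' M) \<cdot>\<^bsub>coef S P\<^esub>
    pull_class S f' d (fobj (pull S h) M) (pull_class S h d M t)"
proof -
  note p = pcomp_props[OF M] and sq = square_iso_homs[OF M]
  note inv = P.inv_arr_iso[OF p(3,2)]
  have "square_iso S f h' h f' M \<cdot>\<^bsub>coef S P\<^esub> pcomp S h f' M = pcomp S f h' M"
    by (simp add: square_iso_eq P.Comp_assoc[OF p(2) inv(1) p(1)] inv(2) P.Idn_right[OF p(1)])
  then show ?thesis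
    using pull_class_homs[OF Comp_homs[OF f' h] M t] P.shA_Comp[OF p(2) sq, of d]
      P.Comp_assoc[OF _ P.shA_homs[OF p(2)] P.shA_homs[OF sq]]
    by (simp add: pull_class_pull_class[OF h' f M t] pull_class_pull_class[OF f' h M t] comm carrier_cohom)
qed

end

end

section \<open>Base change\<close>

locale base_change =
  L: localization S X Z U i j R + L': localization S X' Z' U' i' j' R'
  for S :: "('s, 'f, 'o, 'm) coeff"
    and X Z U i j R X' Z' U' i' j' R' +
  fixes g gZ gU :: 'f
  assumes g: "g \<in> homs (spc S) X' X" and gZ: "gZ \<in> homs (spc S) Z' Z" and gU: "gU \<in> homs (spc S) U' U"
    and closed_square: "i \<cdot>\<^bsub>spc S\<^esub> gZ = g \<cdot>\<^bsub>spc S\<^esub> i'"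
    and open_square: "j \<cdot>\<^bsub>spc S\<^esub> gU = g \<cdot>\<^bsub>spc S\<^esub> j'"
    and beck_chevalley: "beck_chevalley_closed S R R' i gZ g i'"
begin

interpretation g: sym_monoidal_exact_functor "coef S X" "coef S X'" "pull S g"
  by (rule L.pull_functor[OF g])

interpretation gZ: sym_monoidal_exact_functor "coef S Z" "coef S Z'" "pull S gZ"
  by (rule L.pull_functor[OF gZ])

text \<open>Restricting \<open>g\<^sup>* c\<close> to \<open>U'\<close> amounts, up to
  \<open>square_iso\<close>, to pulling \<open>j\<^sup>* c\<close> back along \<open>gU\<close>, and
  both operations are homomorphisms. The open square is read in the orientation in which
  \<open>square_iso\<close> ends at \<open>j'\<^sup>* g\<^sup>* A\<close>.\<close>

lemma pull_class_open_eq_one: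
  assumes A: "A \<in> Obj (coef S X)" and c: "c \<in> carrier (cohom S X d A)"
    and c0: "pull_class S j d A c = \<one>\<^bsub>cohom S U d (fobj (pull S j) A)\<^esub>"
  shows "pull_class S j' d (fobj (pull S g) A) (pull_class S g d A c) =
    \<one>\<^bsub>cohom S U' d (fobj (pull S j') (fobj (pull S g) A))\<^esub>"
proof -
  interpret J: sym_monoidal_exact_functor "coef S X" "coef S U" "pull S j"
    by (rule L.pull_functor[OF L.j])
  have "pull_class S gU d (fobj (pull S j) A) (pull_class S j d A c) =
      \<one>\<^bsub>cohom S U' d (fobj (pull S gU) (fobj (pull S j) A))\<^esub>"
    using group_hom.hom_one[OF L.pull_class_group_hom[OF gU J.fobj_Obj[OF A]]] c0 by simp
  then show ?thesis
    using L.pull_class_square[OF g L'.j L.j gU open_square[symmetric] A c]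
      group_hom.hom_one[OF L.shA_group_hom[OF L.homs_Obj(1)[OF gU]
        L.square_iso_homs[OF g L'.j L.j gU open_square[symmetric] A]]] by simp
qed

section \<open>Exchange morphisms and their compatibility with counits\<close>

context
  fixes A
  assumes A: "A \<in> Obj (coef S X)"
begin

abbreviation (input) "N \<equiv> fobj (ishriek R) A"
abbreviation (input) "N' \<equiv> fobj (ishriek R') (fobj (pull S g) A)"
abbreviation (input) "ex \<equiv> exch_push S i gZ g i' N"
abbreviation (input) "sh \<equiv> exch_shriek S R R' i gZ g i' A"
abbreviation (input) "sq \<equiv> square_iso S i gZ g i' (fobj (push S i) N)"

lemma N: "N \<in> Obj (coef S Z)" and push_N: "fobj (push S i) N \<in> Obj (coef S X)"
  and gA: "fobj (pull S g) A \<in> Obj (coef S X')" and N': "N' \<in> Obj (coef S Z')"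
  by (simp_all add: A L.push_shriek.G.fobj_Obj L'.push_shriek.G.fobj_Obj L.push_i.fobj_Obj g.fobj_Obj)

lemma sq_homs: "sq \<in> homs (coef S Z') (fobj (pull S i') (fobj (pull S g) (fobj (push S i) N)))
    (fobj (pull S gZ) (fobj (pull S i) (fobj (push S i) N)))"
  by (rule L.square_iso_homs[OF L.i gZ g L'.i closed_square push_N])

lemma pull_cnt_sq_homs: "farr (pull S gZ) (cnt S i N) \<cdot>\<^bsub>coef S Z'\<^esub> sq \<in>
    homs (coef S Z') (fobj (pull S i') (fobj (pull S g) (fobj (push S i) N))) (fobj (pull S gZ) N)"
  by (rule L'.pull_i.D.Comp_homs[OF sq_homs gZ.farr_homs[OF L.pull_push.counit_homs[OF N]]])

text \<open>Gathering the two factors under \<open>push S i'\<close> exhibits the exchange morphism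
  as a transpose, the form to which \<open>counit_transpose\<close> applies.\<close>

lemma exch_push_eq: "ex = farr (push S i') (farr (pull S gZ) (cnt S i N) \<cdot>\<^bsub>coef S Z'\<^esub> sq) \<cdot>\<^bsub>coef S X'\<^esub>
    unt S i' (fobj (pull S g) (fobj (push S i) N))"
proof -
  note cn = gZ.farr_homs[OF L.pull_push.counit_homs[OF N]]
  show ?thesis
    using L'.i by (simp add: exch_push_def homs_def Let_def L'.push_i.farr_Comp[OF sq_homs cn]
        L'.pull_i.C.Comp_assoc[OF L'.pull_push.unit_homs[OF g.fobj_Obj[OF push_N]]
          L'.push_i.farr_homs[OF sq_homs] L'.push_i.farr_homs[OF cn]])
qed

lemma exch_push_homs:
  "ex \<in> homs (coef S X') (fobj (pull S g) (fobj (push S i) N)) (fobj (push S i') (fobj (pull S gZ) N))"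
  unfolding exch_push_eq
  by (rule L'.pull_i.C.Comp_homs[OF L'.pull_push.unit_homs[OF g.fobj_Obj[OF push_N]]
        L'.push_i.farr_homs[OF pull_cnt_sq_homs]])

lemma cnt_exch_push: "cnt S i' (fobj (pull S gZ) N) \<cdot>\<^bsub>coef S Z'\<^esub> farr (pull S i') ex =
    farr (pull S gZ) (cnt S i N) \<cdot>\<^bsub>coef S Z'\<^esub> sq"
  unfolding exch_push_eq
  by (rule L'.pull_push.counit_transpose[OF g.fobj_Obj[OF push_N] pull_cnt_sq_homs])

lemma exch_push_inv:
  "inv_arr (coef S X') ex \<in> homs (coef S X') (fobj (push S i') (fobj (pull S gZ) N)) (fobj (pull S g) (fobj (push S i) N))"
  "inv_arr (coef S X') ex \<cdot>\<^bsub>coef S X'\<^esub> ex = Idn (coef S X') (fobj (pull S g) (fobj (push S i) N))"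
proof -
  have "iso_arr (coef S X') ex"
    using beck_chevalley N L.i L'.i by (simp add: beck_chevalley_closed_def homs_def)
  then show "inv_arr (coef S X') ex \<in> homs (coef S X') (fobj (push S i') (fobj (pull S gZ) N)) (fobj (pull S g) (fobj (push S i) N))"
    "inv_arr (coef S X') ex \<cdot>\<^bsub>coef S X'\<^esub> ex = Idn (coef S X') (fobj (pull S g) (fobj (push S i) N))"
    by (rule L'.pull_i.C.inv_arr_iso(1,2)[OF _ exch_push_homs])+
qed

lemma pull_icounit_homs: "farr (pull S g) (icounit R A) \<in>
    homs (coef S X') (fobj (pull S g) (fobj (push S i) N)) (fobj (pull S g) A)"
  by (rule g.farr_homs[OF L.push_shriek.counit_homs[OF A]])

text \<open>The same regrouping for the adjunction
  \<open>i'\<^sub>* \<stileturn> i'\<^sup>!\<close>.\<close>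

lemma exch_shriek_eq: "sh = farr (ishriek R') (farr (pull S g) (icounit R A) \<cdot>\<^bsub>coef S X'\<^esub> inv_arr (coef S X') ex)
    \<cdot>\<^bsub>coef S Z'\<^esub> iunit R' (fobj (pull S gZ) N)"
  using L'.i by (simp add: exch_shriek_def homs_def Let_def
      L'.push_shriek.G.farr_Comp[OF exch_push_inv(1) pull_icounit_homs]
      L'.pull_i.D.Comp_assoc[OF L'.push_shriek.unit_homs[OF gZ.fobj_Obj[OF N]]
        L'.push_shriek.G.farr_homs[OF exch_push_inv(1)] L'.push_shriek.G.farr_homs[OF pull_icounit_homs]])

lemma exch_shriek_homs: "sh \<in> homs (coef S Z') (fobj (pull S gZ) N) N'"
  unfolding exch_shriek_eq
  by (rule L'.pull_i.D.Comp_homs[OF L'.push_shriek.unit_homs[OF gZ.fobj_Obj[OF N]]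
        L'.push_shriek.G.farr_homs[OF L'.pull_i.C.Comp_homs[OF exch_push_inv(1) pull_icounit_homs]]])

lemma icounit_exch_shriek: "icounit R' (fobj (pull S g) A) \<cdot>\<^bsub>coef S X'\<^esub> farr (push S i') sh =
    farr (pull S g) (icounit R A) \<cdot>\<^bsub>coef S X'\<^esub> inv_arr (coef S X') ex"
  unfolding exch_shriek_eq
  by (rule L'.push_shriek.counit_transpose[OF gZ.fobj_Obj[OF N]
        L'.pull_i.C.Comp_homs[OF exch_push_inv(1) pull_icounit_homs]])

text \<open>The transformation \<open>g\<^sup>* i\<^sub>* i\<^sup>! A \<rightarrow> i'\<^sub>* i'\<^sup>! g\<^sup>* A\<close> carrying lifts of \<open>c\<close> to lifts of \<open>g\<^sup>* c\<close>.\<close>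

definition supp_exch :: 'm where
  "supp_exch = farr (push S i') sh \<cdot>\<^bsub>coef S X'\<^esub> ex"

lemma supp_exch_homs:
  "supp_exch \<in> homs (coef S X') (fobj (pull S g) (fobj (push S i) N)) (fobj (push S i') N')"
  unfolding supp_exch_def
  by (rule L'.pull_i.C.Comp_homs[OF exch_push_homs L'.push_i.farr_homs[OF exch_shriek_homs]])

text \<open>Undoing the transpose \<open>sh\<close> leaves the inverse of \<open>ex\<close>, which
  cancels the factor \<open>ex\<close> of \<open>supp_exch\<close>. This compatibility is what makes
  transported classes lifts of \<open>g\<^sup>* c\<close>.\<close>

lemma icounit_supp_exch:
  "icounit R' (fobj (pull S g) A) \<cdot>\<^bsub>coef S X'\<^esub> supp_exch = farr (pull S g) (icounit R A)"
  unfolding supp_exch_def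
  using L'.pull_i.C.Comp_assoc[OF exch_push_homs L'.push_i.farr_homs[OF exch_shriek_homs]
      L'.push_shriek.counit_homs[OF gA]]
    L'.pull_i.C.Comp_assoc[OF exch_push_homs exch_push_inv(1) pull_icounit_homs]
  by (simp add: icounit_exch_shriek exch_push_inv(2) L'.pull_i.C.Idn_right[OF pull_icounit_homs])

text \<open>Naturality of the counit of \<open>i'\<^sup>* \<stileturn> i'\<^sub>*\<close> brings
  \<open>sh\<close> to the front; what remains is the transpose \<open>ex\<close>, undone by
  \<open>cnt_exch_push\<close>.\<close>

lemma cnt_supp_exch: "cnt S i' N' \<cdot>\<^bsub>coef S Z'\<^esub> farr (pull S i') supp_exch =
    sh \<cdot>\<^bsub>coef S Z'\<^esub> farr (pull S gZ) (cnt S i N) \<cdot>\<^bsub>coef S Z'\<^esub> sq"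
proof -
  note psh = L'.push_i.farr_homs[OF exch_shriek_homs] and pex = L'.pull_i.farr_homs[OF exch_push_homs]
  have "cnt S i' N' \<cdot>\<^bsub>coef S Z'\<^esub> farr (pull S i') supp_exch =
      (cnt S i' N' \<cdot>\<^bsub>coef S Z'\<^esub> farr (pull S i') (farr (push S i') sh)) \<cdot>\<^bsub>coef S Z'\<^esub> farr (pull S i') ex"
    by (simp add: supp_exch_def L'.pull_i.farr_Comp[OF exch_push_homs psh]
        L'.pull_i.D.Comp_assoc[OF pex L'.pull_i.farr_homs[OF psh] L'.pull_push.counit_homs[OF N']])
  also have "\<dots> = sh \<cdot>\<^bsub>coef S Z'\<^esub> cnt S i' (fobj (pull S gZ) N) \<cdot>\<^bsub>coef S Z'\<^esub> farr (pull S i') ex"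
    by (simp add: L'.pull_push.counit_square[OF exch_shriek_homs]
        L'.pull_i.D.Comp_assoc[OF pex L'.pull_push.counit_homs[OF gZ.fobj_Obj[OF N]] exch_shriek_homs])
  finally show ?thesis
    by (simp add: cnt_exch_push)
qed

section \<open>Transport of lifts, adjoints and torsors\<close>

lemma Loc_pull_eq: "Loc_pull S R R' i gZ g i' d A s =
    shA (coef S Z') d sh \<cdot>\<^bsub>coef S Z'\<^esub> pull_class S gZ d N s"
  using L'.i by (simp add: Loc_pull_def homs_def Let_def)

lemma Loc_pull_group_hom:
  "group_hom (cohom S Z d N) (cohom S Z' d N') (Loc_pull S R R' i gZ g i' d A)"
  unfolding Loc_pull_eq[abs_def]
  by (rule group_hom_compose[OF L.pull_class_group_hom[OF gZ N]
        L.shA_group_hom[OF L.homs_Obj(1)[OF gZ] exch_shriek_homs]])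

text \<open>Pulling \<open>forg t = c\<close> back along \<open>g\<close> puts
  \<open>g\<^sup>*\<close> of the counit \<open>icounit R A\<close> in front of
  \<open>g\<^sup>* t\<close>, and this map factors through \<open>supp_exch\<close> followed by the
  counit over \<open>X'\<close>.\<close>

lemma Lift_pull:
  assumes "t \<in> Lift S R i d A c"
  shows "shA (coef S X') d supp_exch \<cdot>\<^bsub>coef S X'\<^esub> pull_class S g d (fobj (push S i) N) t
    \<in> Lift S R' i' d (fobj (pull S g) A) (pull_class S g d A c)"
    (is "?t' \<in> _")
proof -
  have t: "t \<in> carrier (cohom S X d (fobj (push S i) N))" and c: "forg S R i d A t = c"
    using assms by (simp_all add: Lift_def L.cohom_supp_eq)
  note gt = L.pull_class_homs[OF g push_N t]
  note ic = L'.push_shriek.counit_homs[OF gA]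
  have "?t' \<in> carrier (cohom_supp S R' i' d (fobj (pull S g) A))"
    unfolding L'.cohom_supp_eq
    by (rule group_hom.hom_closed[OF L.shA_group_hom[OF L.homs_Obj(1)[OF g] supp_exch_homs] gt])
  moreover have "forg S R' i' d (fobj (pull S g) A) ?t' = pull_class S g d A c"
    unfolding L'.forg_eq c[symmetric] L.forg_eq
      L.pull_class_shA[OF g L.push_shriek.counit_homs[OF A] t] icounit_supp_exch[symmetric]
    by (simp add: L'.pull_i.C.shA_Comp[OF supp_exch_homs ic]
        L'.pull_i.C.Comp_assoc[OF gt[unfolded carrier_cohom] L'.pull_i.C.shA_homs[OF supp_exch_homs] L'.pull_i.C.shA_homs[OF ic]])
  ultimately show ?thesis
    by (simp add: Lift_def)
qed

text \<open>The counit of \<open>i'\<close> turns \<open>supp_exch\<close> into \<open>sh\<close>,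
  the pulled back counit of \<open>i\<close> and \<open>sq\<close>. The last factor accounts for
  replacing pullback along \<open>g\<close> and then \<open>i'\<close> by pullback along
  \<open>i\<close> and then \<open>gZ\<close>.\<close>

lemma supp_adj_pull:
  assumes "t \<in> Lift S R i d A c"
  shows "supp_adj S R' i' d (fobj (pull S g) A)
      (shA (coef S X') d supp_exch \<cdot>\<^bsub>coef S X'\<^esub> pull_class S g d (fobj (push S i) N) t) =
    Loc_pull S R R' i gZ g i' d A (supp_adj S R i d A t)"
proof -
  have t: "t \<in> carrier (cohom S X d (fobj (push S i) N))"
    using assms by (simp add: Lift_def L.cohom_supp_eq)
  note gt = L.pull_class_homs[OF g push_N t] and it = L.pull_class_homs[OF L.i push_N t]
  note igt = L.pull_class_homs[OF L'.i g.fobj_Obj[OF push_N] gt]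
  note git = L.pull_class_homs[OF gZ L.pull_i.fobj_Obj[OF push_N] it]
  note cn = L.pull_push.counit_homs[OF N] and cn' = L'.pull_push.counit_homs[OF N']
  note gcn = gZ.farr_homs[OF cn]
  note ik = L'.pull_i.farr_homs[OF supp_exch_homs]
  note shA = L'.pull_i.D.shA_homs[of _ _ _ d]
  let ?igt = "pull_class S i' d (fobj (pull S g) (fobj (push S i) N)) (pull_class S g d (fobj (push S i) N) t)"
  have "supp_adj S R' i' d (fobj (pull S g) A)
      (shA (coef S X') d supp_exch \<cdot>\<^bsub>coef S X'\<^esub> pull_class S g d (fobj (push S i) N) t) =
      shA (coef S Z') d (cnt S i' N' \<cdot>\<^bsub>coef S Z'\<^esub> farr (pull S i') supp_exch) \<cdot>\<^bsub>coef S Z'\<^esub> ?igt"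
    by (simp add: L'.supp_adj_eq L.pull_class_shA[OF L'.i supp_exch_homs gt] L'.pull_i.D.shA_Comp[OF ik cn']
        L'.pull_i.D.Comp_assoc[OF igt[unfolded carrier_cohom] shA[OF ik] shA[OF cn']])
  also have "\<dots> = shA (coef S Z') d sh \<cdot>\<^bsub>coef S Z'\<^esub> shA (coef S Z') d (farr (pull S gZ) (cnt S i N))
      \<cdot>\<^bsub>coef S Z'\<^esub> shA (coef S Z') d sq \<cdot>\<^bsub>coef S Z'\<^esub> ?igt"
    by (simp add: cnt_supp_exch L'.pull_i.D.shA_Comp[OF pull_cnt_sq_homs exch_shriek_homs] L'.pull_i.D.shA_Comp[OF sq_homs gcn]
        L'.pull_i.D.Comp_assoc[OF igt[unfolded carrier_cohom] L'.pull_i.D.Comp_homs[OF shA[OF sq_homs] shA[OF gcn]] shA[OF exch_shriek_homs]]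
        L'.pull_i.D.Comp_assoc[OF igt[unfolded carrier_cohom] shA[OF sq_homs] shA[OF gcn]])
  \<comment> \<open>\<open>pull_class_square\<close> identifies \<open>sq\<close> applied to
    \<open>?igt\<close> with the pullback of \<open>t\<close> along \<open>i\<close> and then
    \<open>gZ\<close>; \<open>pull_class_shA\<close> moves the counit of \<open>i\<close> inside the
    pullback along \<open>gZ\<close>.\<close>
  also have "\<dots> = Loc_pull S R R' i gZ g i' d A (supp_adj S R i d A t)"
    by (simp add: Loc_pull_eq L.supp_adj_eq L.pull_class_shA[OF gZ cn it]
        L.pull_class_square[OF L.i gZ g L'.i closed_square push_N t])
  finally show ?thesis .
qed

lemma Loc_pull_mem:
  assumes "s \<in> Loc_tor S R i d A c"
  shows "Loc_pull S R R' i gZ g i' d A s \<in> Loc_tor S R' i' d (fobj (pull S g) A) (pull_class S g d A c)"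
  using assms Lift_pull by (auto simp: Loc_tor_def supp_adj_pull[symmetric])

text \<open>One homomorphism between the cohomology groups of \<open>Z\<close> and \<open>Z'\<close>
  restricts both to the torsors and to the acting groups, so equivariance is its additivity.\<close>

lemma Loc_pull_torsor_morphism:
  assumes c: "c \<in> carrier (cohom S X d A)"
    and c0: "pull_class S j d A c = \<one>\<^bsub>cohom S U d (fobj (pull S j) A)\<^esub>"
  shows "torsor_morphism
    (Loc_group S R i d A) (Loc_tor S R i d A c) (Loc_act S R i d A c)
    (Loc_group S R' i' d (fobj (pull S g) A)) (Loc_tor S R' i' d (fobj (pull S g) A) (pull_class S g d A c))
    (Loc_act S R' i' d (fobj (pull S g) A) (pull_class S g d A c))
    (Loc_pull S R R' i gZ g i' d A) (Loc_pull S R R' i gZ g i' d A)"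
proof -
  let ?p = "Loc_pull S R R' i gZ g i' d A"
  interpret p: group_hom "cohom S Z d N" "cohom S Z' d N'" ?p
    by (rule Loc_pull_group_hom)
  \<comment> \<open>The acting groups are the torsors of the zero class, and
    \<open>g\<^sup>*\<close> preserves zero, so this is \<open>Loc_pull_mem\<close> for the zero
    class.\<close>
  have ker: "?p k \<in> carrier (Loc_group S R' i' d (fobj (pull S g) A))"
    and kerZ: "k \<in> carrier (cohom S Z d N)"
    if "k \<in> carrier (Loc_group S R i d A)" for k
    using that Loc_pull_mem[of k d "\<one>\<^bsub>cohom S X d A\<^esub>"] L.Loc_tor_subset[OF A]
      group_hom.hom_one[OF L.pull_class_group_hom[OF g A]]
    by (auto simp: L.carrier_Loc_group[OF A] L'.carrier_Loc_group[OF gA])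
  have tor: "s \<in> carrier (cohom S Z d N)" if "s \<in> Loc_tor S R i d A c" for s
    using that L.Loc_tor_subset[OF A] by blast
  have L: "torsor (Loc_group S R i d A) (Loc_tor S R i d A c) (Loc_act S R i d A c)"
    by (rule L.Loc_torsor[OF A c c0])
  interpret act: group_action "Loc_group S R i d A" "Loc_tor S R i d A c" "Loc_act S R i d A c"
    using L by (simp add: torsor_def)
  show ?thesis
    unfolding torsor_morphism_def
  proof (intro conjI ballI)
    show "torsor (Loc_group S R' i' d (fobj (pull S g) A))
        (Loc_tor S R' i' d (fobj (pull S g) A) (pull_class S g d A c))
        (Loc_act S R' i' d (fobj (pull S g) A) (pull_class S g d A c))"
      by (rule L'.Loc_torsor[OF gA L.pull_class_homs[OF g A c] pull_class_open_eq_one[OF A c c0]])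
    show "?p \<in> hom (Loc_group S R i d A) (Loc_group S R' i' d (fobj (pull S g) A))"
      using ker kerZ by (auto simp: hom_def L.mult_Loc_group[OF A] L'.mult_Loc_group[OF gA])
    fix k s
    assume k: "k \<in> carrier (Loc_group S R i d A)" and s: "s \<in> Loc_tor S R i d A c"
    show "?p (Loc_act S R i d A c k s) =
        Loc_act S R' i' d (fobj (pull S g) A) (pull_class S g d A c) (?p k) (?p s)"
      \<comment> \<open>Both actions are restricted functions; membership of \<open>s\<close> and
        \<open>?p s\<close> in the torsors is what unfolds them to sums.\<close>
      using s Loc_pull_mem[OF s] kerZ[OF k] tor[OF s]
      by (simp add: Loc_act_def L.mult_Loc_group[OF A] L'.mult_Loc_group[OF gA])
  qed (use L Loc_pull_mem in auto)
qed

end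

end

theorem proposition4p14:
  fixes S :: "('s, 'f, 'o, 'm) coeff"
    and X Z U X' Z' U' :: 's
    and i j g i' j' gZ gU :: 'f
    and R R' :: "('o, 'm) recoll"
    and A :: 'o and d :: int and c :: 'm
  assumes "coefficient_system S"
    and "i \<in> closed_immersions (spc S)" "i \<in> homs (spc S) Z X"
    and "g \<in> homs (spc S) X' X" "i' \<in> homs (spc S) Z' X'" "gZ \<in> homs (spc S) Z' Z"
    and "cartesian_square (spc S) i gZ g i'"
    and "j \<in> homs (spc S) U X" "open_complement (spc S) i j"
    and "j' \<in> homs (spc S) U' X'" "open_complement (spc S) i' j'"
    and "gU \<in> homs (spc S) U' U" "commutative_square (spc S) j gU g j'"
    and "recollement S i j R" "recollement S i' j' R'"
    and "beck_chevalley_closed S R R' i gZ g i'" "beck_chevalley_open S j gU g j'"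
    and "A \<in> Obj (coef S X)"
    and "c \<in> carrier (cohom S X d A)"
    and "pull_class S j d A c = \<one>\<^bsub>cohom S U d (fobj (pull S j) A)\<^esub>"
  shows "let gA = fobj (pull S g) A;
             gc = pull_class S g d A c;
             gZ_pull = Loc_pull S R R' i gZ g i' d A
         in pull_class S j' d gA gc = \<one>\<^bsub>cohom S U' d (fobj (pull S j') gA)\<^esub> \<and>
            Loc_tor S R' i' d gA gc \<subseteq> carrier (cohom S Z' d (fobj (ishriek R') gA)) \<and>
            torsor_morphism
              (Loc_group S R i d A) (Loc_tor S R i d A c) (Loc_act S R i d A c)
              (Loc_group S R' i' d gA) (Loc_tor S R' i' d gA gc) (Loc_act S R' i' d gA gc)
              gZ_pull gZ_pull \<and>
            (\<forall>l l'. Loc_tor S R i d A c = {l} \<and> Loc_tor S R' i' d gA gc = {l'} \<longrightarrow> l' = gZ_pull l)"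
proof -
  interpret base_change S X Z U i j R X' Z' U' i' j' R' g gZ gU
    using assms
    by (simp add: base_change_def base_change_axioms_def localization_def localization_axioms_def
        cartesian_square_def commutative_square_def)
  note A = \<open>A \<in> Obj (coef S X)\<close> and c = \<open>c \<in> carrier (cohom S X d A)\<close>
    and c0 = \<open>pull_class S j d A c = \<one>\<^bsub>cohom S U d (fobj (pull S j) A)\<^esub>\<close>
  \<comment> \<open>In the singleton case, \<open>Loc_pull_mem\<close> places the image of
    \<open>l\<close> in \<open>{l'}\<close>.\<close>
  show ?thesis
    unfolding Let_def
    using pull_class_open_eq_one[OF A c c0] L'.Loc_tor_subset[OF gA[OF A]]
      Loc_pull_torsor_morphism[OF A c c0] Loc_pull_mem[OF A, of _ d c] by auto
qed

end
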